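(* Let $\Omega \subset \mathbb{R}^d$ be a nonempty bounded open set, let $m \le d$, and let $g_1,\dots,g_m \in C^2(\bar\Omega;\mathbb{R}^d)$ be vector fields. Let $\Delta_H$ be the associated sub-Laplacian on $L^2(\Omega)$, as defined in the context. Suppose $\Delta_H$ is invertible on $L^2_\perp(\Omega)$, i.e. there exists a bounded linear operator $\Delta_H^{-1} : L^2_\perp(\Omega) \to L^2_\perp(\Omega)$, with values in the domain of $\Delta_H$, such that $\Delta_H \Delta_H^{-1} h = h$ for all $h \in L^2_\perp(\Omega)$. Then for every $R > 0$ and every $y \in \Omega$, the set $\mathrm{Reach}^{-1}(B_R(y)) \subseteq \Omega$ of states that can reach the open ball $B_R(y)$ along trajectories in $\Omega$ of the control system $\dot\gamma(t) = \sum_{i=1}^m u_i(t) g_i(\gamma(t))$ has full Lebesgue measure in $\Omega$, i.e. $\Omega \setminus \mathrm{Reach}^{-1}(B_R(y))$ has Lebesgue measure zero.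
   Context: All functions are real-valued; $\langle\cdot,\cdot\rangle_2$ and $\|\cdot\|_2$ are the inner product and norm of $L^2(\Omega)$ with Lebesgue measure. $L^2_\perp(\Omega) = \{h \in L^2(\Omega) : \int_\Omega h\,dx = 0\}$. $B_R(y)$ is the open Euclidean ball in $\mathbb{R}^d$ of radius $R$ centred at $y$. Derivatives along vector fields: write $g_i = (g_i^1,\dots,g_i^d)$. For smooth $h$, $X_i h = \sum_{j=1}^d g_i^j \partial_{x_j} h$ and $X_i^* h = -\sum_{j=1}^d \partial_{x_j}(g_i^j h)$. A function $f \in L^2(\Omega)$ has weak derivative $X_i f = w \in L^2(\Omega)$ along $g_i$ if $\int_\Omega w\,\phi\,dx = \int_\Omega f\, X_i^*\phi\,dx$ for all $\phi \in C_0^\infty(\Omega)$ (smooth functions compactly supported in $\Omega$). Horizontal Sobolev space: $WH^1(\Omega) = \{u \in L^2(\Omega) : X_i u \in L^2(\Omega),\ i = 1,\dots,m\}$ with norm $\|u\|_2 + \sum_{i=1}^m \|X_i u\|_2$. Sub-Laplacian: formally $\Delta_H h = -\sum_{i=1}^m X_i^* X_i h$. Rigorously, let $\sigma(u,\phi) = \sum_{i=1}^m \int_\Omega X_i u\, X_i\phi\,dx$ for $u,\phi \in WH^1(\Omega)$. The domain of $\Delta_H$ is the set of $u \in WH^1(\Omega)$ for which there is $f \in L^2(\Omega)$ with $\sigma(u,\phi) = \langle f,\phi\rangle_2$ for all $\phi \in WH^1(\Omega)$; for such $u$, $\Delta_H u = -f$. Reachability: a trajectory in $\Omega$ is an absolutely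 continuous curve $\gamma:[0,1]\to\mathbb{R}^d$ with $\dot\gamma \in L^2(0,1;\mathbb{R}^d)$ and $\gamma(t) \in \Omega$ for all $t \in [0,1]$, for which there is a control $u \in L^2(0,1;\mathbb{R}^m)$ with $\dot\gamma(t) = \sum_{i=1}^m u_i(t) g_i(\gamma(t))$ for a.e. $t \in (0,1)$. For $B \subseteq \mathbb{R}^d$, $\mathrm{Reach}^{-1}(B)$ is the set of $x \in \Omega$ for which there is a trajectory $\gamma$ in $\Omega$ with $\gamma(0) = x$ and $\gamma(1) \in B$. *)

theory Defs
  imports "HOL-Analysis.Analysis"
begin

section \<open>Classical differentiability\<close>

definition partial :: "'d \<Rightarrow> (real^'d \<Rightarrow> 'b::real_normed_vector) \<Rightarrow> real^'d \<Rightarrow> 'b"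
  where "partial j f x = frechet_derivative f (at x) (axis j 1)"

text \<open>\<open>C_k_on k f S\<close> is meant for open \<open>S\<close>.\<close>

primrec C_k_on :: "nat \<Rightarrow> (real^'d \<Rightarrow> 'b::real_normed_vector) \<Rightarrow> (real^'d) set \<Rightarrow> bool"
  where
    "C_k_on 0 f S \<longleftrightarrow> continuous_on S f"
  | "C_k_on (Suc k) f S \<longleftrightarrow> f differentiable_on S \<and> (\<forall>j. C_k_on k (partial j f) S)"

definition extends_continuously :: "(real^'d \<Rightarrow> 'b::real_normed_vector) \<Rightarrow> (real^'d) set \<Rightarrow> bool"
  where "extends_continuously f S \<longleftrightarrow>
    (\<exists>F. continuous_on (closure S) F \<and> (\<forall>x\<in>S. F x = f x))"

text \<open>
  \<open>C_k_closure k f S\<close> is the condition $f \in C^k(\overline{S})$ for open \<open>S\<close>: \<open>f\<close> is of class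
  $C^k$ in \<open>S\<close>, and all its partial derivatives of order at most \<open>k\<close> extend continuously to the
  closure. The values of \<open>f\<close> outside \<open>S\<close> play no role.
\<close>

primrec C_k_closure :: "nat \<Rightarrow> (real^'d \<Rightarrow> 'b::real_normed_vector) \<Rightarrow> (real^'d) set \<Rightarrow> bool"
  where
    "C_k_closure 0 f S \<longleftrightarrow> extends_continuously f S"
  | "C_k_closure (Suc k) f S \<longleftrightarrow>
       extends_continuously f S \<and> f differentiable_on S \<and> (\<forall>j. C_k_closure k (partial j f) S)"

text \<open>$C_0^\infty(\Omega)$, each function being identified with its extension by zero.\<close>

definition test_functions :: "(real^'d) set \<Rightarrow> (real^'d \<Rightarrow> real) set"
  where "test_functions \<Omega> = {\<phi>. (\<forall>k. C_k_on k \<phi> UNIV) \<and>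
    compact (closure {x. \<phi> x \<noteq> 0}) \<and> closure {x. \<phi> x \<noteq> 0} \<subseteq> \<Omega>}"

section \<open>Square integrable functions\<close>

text \<open>
  Elements of $L^2$ are represented by functions; equality in $L^2$ is equality almost everywhere.
\<close>

definition L2_fun :: "'a measure \<Rightarrow> ('a \<Rightarrow> 'b::euclidean_space) set"
  where "L2_fun M = {f \<in> borel_measurable M. integrable M (\<lambda>x. (norm (f x))\<^sup>2)}"

definition L2_inner :: "'a measure \<Rightarrow> ('a \<Rightarrow> real) \<Rightarrow> ('a \<Rightarrow> real) \<Rightarrow> real"
  where "L2_inner M f h = (\<integral>x. f x * h x \<partial>M)"

definition L2_norm :: "'a measure \<Rightarrow> ('a \<Rightarrow> real) \<Rightarrow> real"
  where "L2_norm M f = sqrt (L2_inner M f f)"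

definition L2_perp :: "(real^'d) set \<Rightarrow> (real^'d \<Rightarrow> real) set"
  where "L2_perp \<Omega> = {h \<in> L2_fun (lebesgue_on \<Omega>). (\<integral>x. h x \<partial>lebesgue_on \<Omega>) = 0}"

text \<open>
  A bounded linear operator from a subspace \<open>V\<close> of $L^2$ to itself. The second conjunct says
  that \<open>T\<close> acts on almost-everywhere classes.
\<close>

definition bounded_linear_op_L2 ::
    "'a measure \<Rightarrow> ('a \<Rightarrow> real) set \<Rightarrow> (('a \<Rightarrow> real) \<Rightarrow> ('a \<Rightarrow> real)) \<Rightarrow> bool"
  where "bounded_linear_op_L2 M V T \<longleftrightarrow>
    (\<forall>h\<in>V. T h \<in> V) \<and>
    (\<forall>h\<in>V. \<forall>k\<in>V. (AE x in M. h x = k x) \<longrightarrow> (AE x in M. T h x = T k x)) \<and>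
    (\<forall>h\<in>V. \<forall>k\<in>V. AE x in M. T (\<lambda>z. h z + k z) x = T h x + T k x) \<and>
    (\<forall>c. \<forall>h\<in>V. AE x in M. T (\<lambda>z. c * h z) x = c * T h x) \<and>
    (\<exists>C. \<forall>h\<in>V. L2_norm M (T h) \<le> C * L2_norm M h)"

section \<open>Derivatives along vector fields\<close>

text \<open>$X^* h = -\sum_j \partial_{x_j}(g^j h)$ for the vector field \<open>g\<close>.\<close>

definition X_adj :: "(real^'d \<Rightarrow> real^'d) \<Rightarrow> (real^'d \<Rightarrow> real) \<Rightarrow> real^'d \<Rightarrow> real"
  where "X_adj g h x = - (\<Sum>j\<in>UNIV. partial j (\<lambda>z. g z $ j * h z) x)"

definition has_weak_X ::
    "(real^'d) set \<Rightarrow> (real^'d \<Rightarrow> real^'d) \<Rightarrow> (real^'d \<Rightarrow> real) \<Rightarrow> (real^'d \<Rightarrow> real) \<Rightarrow> bool"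
  where "has_weak_X \<Omega> g f w \<longleftrightarrow>
    f \<in> L2_fun (lebesgue_on \<Omega>) \<and> w \<in> L2_fun (lebesgue_on \<Omega>) \<and>
    (\<forall>\<phi>\<in>test_functions \<Omega>.
      (\<integral>x. w x * \<phi> x \<partial>lebesgue_on \<Omega>) = (\<integral>x. f x * X_adj g \<phi> x \<partial>lebesgue_on \<Omega>))"

text \<open>The weak derivative is unique up to null sets; an arbitrary representative is chosen.\<close>

definition weak_X ::
    "(real^'d) set \<Rightarrow> (real^'d \<Rightarrow> real^'d) \<Rightarrow> (real^'d \<Rightarrow> real) \<Rightarrow> real^'d \<Rightarrow> real"
  where "weak_X \<Omega> g f = (SOME w. has_weak_X \<Omega> g f w)"

section \<open>The sub-Laplacian\<close>

text \<open>Here and below the vector fields are \<open>g 0, \<dots>, g (m - 1)\<close>.\<close>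

definition WH1 :: "(real^'d) set \<Rightarrow> nat \<Rightarrow> (nat \<Rightarrow> real^'d \<Rightarrow> real^'d) \<Rightarrow> (real^'d \<Rightarrow> real) set"
  where "WH1 \<Omega> m g = {u \<in> L2_fun (lebesgue_on \<Omega>). \<forall>i<m. \<exists>w. has_weak_X \<Omega> (g i) u w}"

definition sigma_form ::
    "(real^'d) set \<Rightarrow> nat \<Rightarrow> (nat \<Rightarrow> real^'d \<Rightarrow> real^'d) \<Rightarrow> (real^'d \<Rightarrow> real) \<Rightarrow> (real^'d \<Rightarrow> real) \<Rightarrow> real"
  where "sigma_form \<Omega> m g u \<phi> =
    (\<Sum>i<m. \<integral>x. weak_X \<Omega> (g i) u x * weak_X \<Omega> (g i) \<phi> x \<partial>lebesgue_on \<Omega>)"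

definition sigma_represents ::
    "(real^'d) set \<Rightarrow> nat \<Rightarrow> (nat \<Rightarrow> real^'d \<Rightarrow> real^'d) \<Rightarrow> (real^'d \<Rightarrow> real) \<Rightarrow> (real^'d \<Rightarrow> real) \<Rightarrow> bool"
  where "sigma_represents \<Omega> m g u f \<longleftrightarrow> f \<in> L2_fun (lebesgue_on \<Omega>) \<and>
    (\<forall>\<phi>\<in>WH1 \<Omega> m g. sigma_form \<Omega> m g u \<phi> = L2_inner (lebesgue_on \<Omega>) f \<phi>)"

definition sub_laplacian_dom ::
    "(real^'d) set \<Rightarrow> nat \<Rightarrow> (nat \<Rightarrow> real^'d \<Rightarrow> real^'d) \<Rightarrow> (real^'d \<Rightarrow> real) set"
  where "sub_laplacian_dom \<Omega> m g = {u \<in> WH1 \<Omega> m g. \<exists>f. sigma_represents \<Omega> m g u f}"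

text \<open>
  As $WH^1(\Omega)$ is dense in $L^2(\Omega)$, the representing function is unique up to null sets.
\<close>

definition sub_laplacian ::
    "(real^'d) set \<Rightarrow> nat \<Rightarrow> (nat \<Rightarrow> real^'d \<Rightarrow> real^'d) \<Rightarrow> (real^'d \<Rightarrow> real) \<Rightarrow> real^'d \<Rightarrow> real"
  where "sub_laplacian \<Omega> m g u x = - (SOME f. sigma_represents \<Omega> m g u f) x"

definition sub_laplacian_invertible ::
    "(real^'d) set \<Rightarrow> nat \<Rightarrow> (nat \<Rightarrow> real^'d \<Rightarrow> real^'d) \<Rightarrow> bool"
  where "sub_laplacian_invertible \<Omega> m g \<longleftrightarrow>
    (\<exists>T. bounded_linear_op_L2 (lebesgue_on \<Omega>) (L2_perp \<Omega>) T \<and>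
      (\<forall>h\<in>L2_perp \<Omega>. T h \<in> sub_laplacian_dom \<Omega> m g \<and>
        (AE x in lebesgue_on \<Omega>. sub_laplacian \<Omega> m g (T h) x = h x)))"

section \<open>Trajectories and reachability\<close>

definition absolutely_continuous_curve :: "real \<Rightarrow> real \<Rightarrow> (real \<Rightarrow> 'b::metric_space) \<Rightarrow> bool"
  where "absolutely_continuous_curve a b \<gamma> \<longleftrightarrow>
    (\<forall>\<epsilon>>0. \<exists>\<delta>>0. \<forall>(n::nat) s t.
      (\<forall>k<n. a \<le> s k \<and> s k \<le> t k \<and> t k \<le> b) \<and>
      disjoint_family_on (\<lambda>k. {s k<..<t k}) {..<n} \<and>
      (\<Sum>k<n. t k - s k) < \<delta>
      \<longrightarrow> (\<Sum>k<n. dist (\<gamma> (s k)) (\<gamma> (t k))) < \<epsilon>)"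

text \<open>
  An absolutely continuous curve is differentiable almost everywhere, so that the arbitrary values
  of \<open>vector_derivative\<close> at the remaining times are immaterial.
\<close>

definition trajectory ::
    "(real^'d) set \<Rightarrow> nat \<Rightarrow> (nat \<Rightarrow> real^'d \<Rightarrow> real^'d) \<Rightarrow> (real \<Rightarrow> real^'d) \<Rightarrow> bool"
  where "trajectory \<Omega> m g \<gamma> \<longleftrightarrow>
    absolutely_continuous_curve 0 1 \<gamma> \<and>
    (\<lambda>t. vector_derivative \<gamma> (at t)) \<in> L2_fun (lebesgue_on {0<..<1}) \<and>
    (\<forall>t\<in>{0..1}. \<gamma> t \<in> \<Omega>) \<and>
    (\<exists>u :: nat \<Rightarrow> real \<Rightarrow> real.
      (\<forall>i<m. u i \<in> L2_fun (lebesgue_on {0<..<1})) \<and>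
      (AE t in lebesgue_on {0<..<1}.
        (\<gamma> has_vector_derivative (\<Sum>i<m. u i t *\<^sub>R g i (\<gamma> t))) (at t)))"

definition Reach_inv ::
    "(real^'d) set \<Rightarrow> nat \<Rightarrow> (nat \<Rightarrow> real^'d \<Rightarrow> real^'d) \<Rightarrow> (real^'d) set \<Rightarrow> (real^'d) set"
  where "Reach_inv \<Omega> m g B = {x \<in> \<Omega>. \<exists>\<gamma>. trajectory \<Omega> m g \<gamma> \<and> \<gamma> 0 = x \<and> \<gamma> 1 \<in> B}"

end

theory Submission
  imports Defs
begin

text \<open>
  Fix $y$ and $R$, and suppose first that the set $A$ of states that reach $B_R(y)$ is open. Then $A$
  and its complement in $\Omega$ are both invariant under the flow of every field $\phi g_i$ with a
  test function $\phi$, because an integral curve of $\phi g_i$ is a trajectory, with control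
  $u_i = \phi \circ \gamma$, and it can be run backwards. A flow that maps $A$ onto itself preserves
  the volume of $A$, so that $\int_A \mathrm{div}(\phi g_i) = 0$. Since
  $X_i^*\phi = -\mathrm{div}(\phi g_i)$, this says that the indicator function of $A$ has weak
  derivative $0$ along each $g_i$. Hence $\sigma(u, 1_A) = 0$ for all $u$, and with
  $u = \Delta_H^{-1} h$ this becomes $\int_A h = 0$ for every $h \in L^2_\perp(\Omega)$. The choice
  $h = 1_A - |A|/|\Omega|$ forces $|A| = 0$ or $|A| = |\Omega|$, and $A$ contains a neighbourhood
  of $y$.

  The proof works with the interior $U$ of the set of states that reach the ball along particularly
  regular trajectories. The interior inherits the invariance, because integral curves depend
  continuously on their starting points (lemma \<open>interior_regularly_reaching_invariant\<close>), and it is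
  measurable for free.

  The step from invariance to $\int_U \mathrm{div}\, v = 0$ is
  \<open>integral_divergence_over_invariant_set\<close>. It avoids differentiating the flow in the initial value.
  The flow is approximated by iterating a map $\Psi_h$ that is a composition of shears
  $x \mapsto x + h\, v_j(x)\, e_j$, one for each coordinate; $\Psi_h$ is a first order
  scheme for $\dot x = v(x)$, and its Jacobian is a product of the factors
  $1 + h\, \partial_j v_j = 1 + O(h)$. The change of variables for a single shear
  (\<open>shear_change_of_variables\<close>) needs no determinants: for smooth integrands, the derivative of
  $\int f(x + h w e) (1 + h\, \partial_e w)\, dx$ with respect to $h$ is the integral of a directional
  derivative of a compactly supported function. Smooth bump functions that converge to indicators of boxes carry it over to all
  Borel functions.

  The same bump functions show that a function with vanishing integral against all test
  functions is zero almost everywhere (\<open>AE_eq_0_if_test_integrals_0\<close>), which identifies the chosen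
  representative of the weak derivative of the indicator function.
\<close>

section \<open>Smooth bump functions\<close>

text \<open>
  The functions $q(1/t)\, e^{-1/t}$, extended by zero to $t \le 0$. Keeping the polynomial $q$ as a
  parameter makes the family closed under differentiation, so that smoothness is an induction.
\<close>

definition flat_exp :: "real poly \<Rightarrow> real \<Rightarrow> real"
  where "flat_exp q t = (if t > 0 then poly q (1 / t) * exp (- (1 / t)) else 0)"

lemma poly_times_exp_minus_tendsto_0:
  fixes q :: "real poly"
  shows "((\<lambda>s. poly q s * exp (- s)) \<longlongrightarrow> 0) at_top"
proof -
  have "((\<lambda>s. \<Sum>i\<le>degree q. coeff q i * (s ^ i / exp s)) \<longlongrightarrow> (\<Sum>i\<le>degree q. coeff q i * 0)) at_top"
    by (intro tendsto_sum tendsto_mult tendsto_const tendsto_power_div_exp_0)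
  moreover have "(\<lambda>s. \<Sum>i\<le>degree q. coeff q i * (s ^ i / exp s)) = (\<lambda>s. poly q s * exp (- s))"
    by (auto simp: poly_altdef sum_distrib_right exp_minus divide_inverse mult.assoc)
  ultimately show ?thesis by simp
qed

text \<open>
  With $s = 1/t$ the derivative of $q(s) e^{-s}$ is $(q'(s) - q(s)) e^{-s} \cdot (-s^2)$. At $t = 0$
  the difference quotient is $s\, q(s) e^{-s}$, which tends to $0$ as $s \to \infty$.
\<close>

lemma DERIV_flat_exp:
  "(flat_exp q has_real_derivative flat_exp ((q - pderiv q) * [:0, 0, 1:]) t) (at t)"
proof -
  consider "t > 0" | "t < 0" | "t = 0" by linarith
  then show ?thesis
  proof cases
    case 1
    have "((\<lambda>t. poly q (1 / t) * exp (- (1 / t))) has_real_derivative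
       flat_exp ((q - pderiv q) * [:0, 0, 1:]) t) (at t)"
      using 1 by (auto intro!: derivative_eq_intros DERIV_chain2[OF poly_DERIV]
          simp: flat_exp_def field_simps power2_eq_square)
    moreover have "eventually (\<lambda>s. poly q (1 / s) * exp (- (1 / s)) = flat_exp q s) (nhds t)"
      using eventually_nhds_in_open[of "{0<..}" t] 1 by (auto simp: flat_exp_def elim!: eventually_mono)
    ultimately show ?thesis using DERIV_cong_ev[of t t "\<lambda>t. poly q (1 / t) * exp (- (1 / t))" "flat_exp q"] by blast
  next
    case 2
    have "eventually (\<lambda>s. 0 = flat_exp q s) (nhds t)"
      using eventually_nhds_in_open[of "{..<0}" t] 2 by (auto simp: flat_exp_def elim!: eventually_mono)
    then show ?thesis using DERIV_cong_ev[of t t "\<lambda>t. 0" "flat_exp q" 0 0] 2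
      by (auto simp: flat_exp_def)
  next
    case 3
    have "((\<lambda>h. poly (q * [:0, 1:]) (inverse h) * exp (- (inverse h))) \<longlongrightarrow> 0) (at_right 0)"
      by (rule filterlim_compose[OF poly_times_exp_minus_tendsto_0 filterlim_inverse_at_top_right])
    moreover have "eventually (\<lambda>h. poly (q * [:0, 1:]) (inverse h) * exp (- (inverse h))
        = (flat_exp q (0 + h) - flat_exp q 0) / h) (at_right 0)"
      by (auto simp: eventually_at_filter flat_exp_def field_simps)
    ultimately have r: "((\<lambda>h. (flat_exp q (0 + h) - flat_exp q 0) / h) \<longlongrightarrow> 0) (at_right 0)"
      by (rule Lim_transform_eventually)
    have l: "((\<lambda>h. (flat_exp q (0 + h) - flat_exp q 0) / h) \<longlongrightarrow> 0) (at_left 0)"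
      by (rule Lim_transform_eventually[OF tendsto_const[of 0]])
         (auto simp: eventually_at_filter flat_exp_def)
    show ?thesis using l r 3 by (simp add: DERIV_def filterlim_split_at flat_exp_def)
  qed
qed

lemma partial_eqI: "(f has_derivative f') (at x) \<Longrightarrow> partial j f x = f' (axis j 1)"
  unfolding partial_def using frechet_derivative_at by metis

lemma C_k_on_imp_continuous: "C_k_on k f UNIV \<Longrightarrow> continuous_on UNIV f"
  by (cases k) (auto intro: differentiable_imp_continuous_on)

lemma C_k_on_const: "C_k_on k (\<lambda>x::real^'d. c :: real) UNIV"
proof (induction k arbitrary: c)
  case (Suc k)
  have "partial j (\<lambda>x::real^'d. c) = (\<lambda>x. 0)" for j
    by (rule ext, subst partial_eqI[OF has_derivative_const]) simp
  then have "C_k_on k (partial j (\<lambda>x::real^'d. c)) UNIV" for j by (metis Suc.IH)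
  then show ?case by simp
qed simp

lemma C_k_on_flat_exp_coordinate: "C_k_on k (\<lambda>x. c * flat_exp q (a * x $ i + b)) UNIV"
proof (induction k arbitrary: c q)
  case 0
  have "continuous_on UNIV (flat_exp q)"
    using DERIV_flat_exp by (meson DERIV_continuous_on has_field_derivative_at_within)
  then show ?case
    by (auto intro!: continuous_intros continuous_on_compose2[of UNIV "flat_exp q"])
next
  case (Suc k)
  define q' where "q' = (q - pderiv q) * [:0, 0, 1:]"
  have D: "((\<lambda>x. c * flat_exp q (a * x $ i + b)) has_derivative
      (\<lambda>h. c * (flat_exp q' (a * x $ i + b) * (a * h $ i)))) (at x)" for x :: "real^'a"
  proof -
    have "((\<lambda>x. a * x $ i + b) has_derivative (\<lambda>h. a * h $ i)) (at x)"
      by (auto intro!: derivative_eq_intros bounded_linear_imp_has_derivative bounded_linear_vec_nth)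
    then have "((\<lambda>x. flat_exp q (a * x $ i + b)) has_derivative
        (\<lambda>h. flat_exp q' (a * x $ i + b) * (a * h $ i))) (at x)"
      using has_derivative_compose[of "\<lambda>x. a * x $ i + b" "\<lambda>h. a * h $ i" x UNIV "flat_exp q"
         "(*) (flat_exp q' (a * x $ i + b))"]
        DERIV_flat_exp[of q "a * x $ i + b"] by (auto simp: has_field_derivative_def q'_def)
    then show ?thesis by (intro has_derivative_mult_right)
  qed
  have "partial j (\<lambda>x. c * flat_exp q (a * x $ i + b)) =
     (\<lambda>x. (c * a * axis j 1 $ i) * flat_exp q' (a * x $ i + b))" for j
    by (rule ext, subst partial_eqI[OF D]) simp
  then show ?case using Suc[of _ q'] D by (auto simp: differentiable_on_def differentiable_def intro: has_derivative_at_withinI)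
qed

lemma C_k_on_add:
  "C_k_on k f UNIV \<Longrightarrow> C_k_on k h UNIV \<Longrightarrow> C_k_on k (\<lambda>x. f x + h x :: real) UNIV"
proof (induction k arbitrary: f h)
  case (Suc k)
  have "partial j (\<lambda>x. f x + h x) = (\<lambda>x. partial j f x + partial j h x)" for j
  proof
    fix x
    obtain f' h' where "(f has_derivative f') (at x)" "(h has_derivative h') (at x)"
      using Suc.prems unfolding C_k_on.simps differentiable_on_def differentiable_def
      by (metis UNIV_I)
    then show "partial j (\<lambda>x. f x + h x) x = partial j f x + partial j h x"
      by (simp add: partial_eqI[OF has_derivative_add] partial_eqI)
  qed
  then show ?case using Suc by auto
qed (auto intro: continuous_intros)

lemma C_k_on_SucD: "C_k_on (Suc k) f UNIV \<Longrightarrow> C_k_on k f UNIV"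
  by (induction k arbitrary: f) (auto intro: differentiable_imp_continuous_on)

lemma C_k_on_mult:
  "C_k_on k f UNIV \<Longrightarrow> C_k_on k h UNIV \<Longrightarrow> C_k_on k (\<lambda>x. f x * h x :: real) UNIV"
proof (induction k arbitrary: f h)
  case (Suc k)
  have "partial j (\<lambda>x. f x * h x) = (\<lambda>x. f x * partial j h x + partial j f x * h x)" for j
  proof
    fix x
    obtain f' h' where "(f has_derivative f') (at x)" "(h has_derivative h') (at x)"
      using Suc.prems unfolding C_k_on.simps differentiable_on_def differentiable_def
      by (metis UNIV_I)
    then show "partial j (\<lambda>x. f x * h x) x = f x * partial j h x + partial j f x * h x"
      by (simp add: partial_eqI[OF has_derivative_mult] partial_eqI)
  qed
  moreover have "C_k_on k f UNIV" "C_k_on k h UNIV" using Suc.prems C_k_on_SucD by blast+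
  ultimately show ?case using Suc by (auto intro!: C_k_on_add)
qed (auto intro: continuous_intros)

lemma C_k_on_prod:
  assumes "finite I" "\<And>i. i \<in> I \<Longrightarrow> C_k_on k (f i) UNIV"
  shows "C_k_on k (\<lambda>x. \<Prod>i\<in>I. f i x :: real) UNIV"
  using assms by (induction I rule: finite_induct) (auto intro: C_k_on_const C_k_on_mult)

text \<open>
  The index \<open>n\<close> rescales the argument of $e^{-1/t}$, which pushes its values on $t > 0$ up to $1$.
\<close>

definition box_bump :: "real^'d \<Rightarrow> real^'d \<Rightarrow> nat \<Rightarrow> real^'d \<Rightarrow> real"
  where "box_bump a b n x = (\<Prod>i\<in>UNIV.
    flat_exp 1 (real (Suc n) * (x $ i - a $ i)) * flat_exp 1 (real (Suc n) * (b $ i - x $ i)))"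

lemma flat_exp_1_bounds: "0 \<le> flat_exp 1 t" "flat_exp 1 t \<le> 1" "flat_exp 1 t > 0 \<longleftrightarrow> t > 0"
  by (auto simp: flat_exp_def)

lemma box_bump_bounds: "0 \<le> box_bump a b n x" "box_bump a b n x \<le> 1"
  unfolding box_bump_def
  by (intro prod_nonneg prod_le_1 ballI conjI mult_nonneg_nonneg mult_le_one flat_exp_1_bounds)+

lemma box_bump_eq_0: "x \<notin> box a b \<Longrightarrow> box_bump a b n x = 0"
  by (auto simp: box_bump_def mem_box_cart flat_exp_def zero_less_mult_iff)

lemma box_bump_test_function:
  assumes "cbox a b \<subseteq> \<Omega>"
  shows "box_bump a b n \<in> test_functions \<Omega>"
proof -
  have "C_k_on k (box_bump a b n) UNIV" for k
  proof -
    have "C_k_on k (\<lambda>x. flat_exp 1 (c * (x $ i - a $ i))) UNIV"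
         "C_k_on k (\<lambda>x. flat_exp 1 (c * (b $ i - x $ i))) UNIV" for c i
      using C_k_on_flat_exp_coordinate[of k 1 1 c i "- c * a $ i"]
        C_k_on_flat_exp_coordinate[of k 1 1 "- c" i "c * b $ i"] by (simp_all add: algebra_simps)
    then show ?thesis unfolding box_bump_def by (intro C_k_on_prod C_k_on_mult finite)
  qed
  moreover have "closure {x. box_bump a b n x \<noteq> 0} \<subseteq> cbox a b"
    by (rule closure_minimal) (use box_bump_eq_0 box_subset_cbox in \<open>blast+\<close>)
  moreover from this have "compact (closure {x. box_bump a b n x \<noteq> 0})"
    using compact_cbox compact_closure bounded_closure_image bounded_subset closed_closure
      compact_eq_bounded_closed by (metis bounded_cbox)
  ultimately show ?thesis using assms by (auto simp: test_functions_def)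
qed

lemma box_bump_tendsto_indicator: "(\<lambda>n. box_bump a b n x) \<longlonglongrightarrow> indicator (box a b) x"
proof (cases "x \<in> box a b")
  case True
  have *: "(\<lambda>n. flat_exp 1 (real (Suc n) * t)) \<longlonglongrightarrow> 1" if "t > 0" for t
  proof -
    have "(\<lambda>n. exp (- (1 / t * inverse (real (Suc n))))) \<longlonglongrightarrow> exp (- (1 / t * 0))"
      by (intro tendsto_intros LIMSEQ_inverse_real_of_nat)
    moreover have "flat_exp 1 (real (Suc n) * t) = exp (- (1 / t * inverse (real (Suc n))))" for n
    proof -
      have "real (Suc n) * t > 0" using that by (intro mult_pos_pos) auto
      then show ?thesis unfolding flat_exp_def by (simp add: divide_inverse mult.commute)
    qed
    ultimately show ?thesis by simp
  qed
  have "(\<lambda>n. box_bump a b n x) \<longlonglongrightarrow> (\<Prod>i\<in>(UNIV::'a set). 1 * 1)"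
    unfolding box_bump_def using True
    by (intro tendsto_prod tendsto_mult *) (auto simp: mem_box_cart)
  then show ?thesis using True by simp
qed (simp add: box_bump_eq_0)

lemma test_function_continuous: "\<phi> \<in> test_functions \<Omega> \<Longrightarrow> continuous_on UNIV \<phi>"
  using C_k_on_imp_continuous by (auto simp: test_functions_def)

text \<open>
  Boxes form a generator of the Borel sets that is stable under intersection. The total integral is
  a separate hypothesis because the whole space is not a box.
\<close>

lemma AE_eq_0_if_box_integrals_0:
  fixes w :: "'a::euclidean_space \<Rightarrow> real"
  assumes int: "integrable lborel w" and tot: "integral\<^sup>L lborel w = 0"
    and box: "\<And>a b. (LINT x:box a b|lborel. w x) = 0"
  shows "AE x in lborel. w x = 0"
proof -
  have "(LINT x:A|lborel. w x) = 0" if "A \<in> sets borel" for A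
  proof -
    have si: "set_integrable lborel A w" if "A \<in> sets borel" for A
      unfolding set_integrable_def using integrable_mult_indicator[of A lborel w] int that by simp
    have stable: "Int_stable (range (\<lambda>(a, b). box a b :: 'a set))"
      by (auto simp: Int_stable_def box_Int_box)
    have pow: "range (\<lambda>(a, b). box a b :: 'a set) \<subseteq> Pow UNIV" by simp
    have "A \<in> sigma_sets UNIV (range (\<lambda>(a, b). box a b))" using that by (simp add: borel_eq_box)
    from stable pow this show ?thesis
    proof (induction A rule: sigma_sets_induct_disjoint)
      case empty
      show ?case by (simp add: set_lebesgue_integral_def)
    next
      case (compl A)
      then have A: "A \<in> sets borel" by (simp add: borel_eq_box)
      have "(LINT x:(UNIV - A) \<union> A|lborel. w x) = (LINT x:UNIV - A|lborel. w x) + (LINT x:A|lborel. w x)"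
        using A si by (intro set_integral_Un) auto
      then show ?case using compl tot by (simp add: set_lebesgue_integral_def)
    next
      case (union A)
      then have A: "A i \<in> sets borel" for i by (auto simp: borel_eq_box)
      have "(LINT x:(\<Union>i. A i)|lborel. w x) = (\<Sum>i. LINT x:A i|lborel. w x)"
        using A si union by (intro lebesgue_integral_countable_add) (auto simp: disjoint_family_on_def)
      then show ?case using union by simp
    qed (auto simp: Int_stable_def box box_Int_box)
  qed
  then show ?thesis
    by (intro density_unique_real int) (auto simp: set_lebesgue_integral_def)
qed

section \<open>Functions that are orthogonal to all test functions\<close>

text \<open>
  The fundamental lemma of the calculus of variations. Bump functions give zero integrals over all
  boxes whose closure lies in the domain; countably many such closed boxes cover it.
\<close>

lemma AE_eq_0_if_test_integrals_0:
  fixes w :: "real^'d \<Rightarrow> real"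
  assumes "open \<Omega>" and w: "integrable (lebesgue_on \<Omega>) w"
    and test: "\<And>\<phi>. \<phi> \<in> test_functions \<Omega> \<Longrightarrow> (\<integral>x. w x * \<phi> x \<partial>lebesgue_on \<Omega>) = 0"
  shows "AE x in lebesgue_on \<Omega>. w x = 0"
proof -
  have \<Omega>: "\<Omega> \<inter> space lebesgue \<in> sets lebesgue" "\<Omega> \<in> sets lebesgue"
    using \<open>open \<Omega>\<close> by auto
  define W where "W x = indicator \<Omega> x * w x" for x
  have W: "integrable lebesgue W"
    using w integrable_restrict_space[OF \<Omega>(1), of w] by (simp add: W_def[abs_def])
  \<comment> \<open>Boxes generate the Borel sets only, so \<open>w\<close> is replaced by a Borel function.\<close>
  obtain w' where w'[measurable]: "w' \<in> borel_measurable lborel" and ae: "AE x in lborel. W x = w' x"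
    using completion_ex_borel_measurable_real[of W lborel] W by auto
  have ae': "AE x in lebesgue. W x = w' x" using ae AE_completion by blast
  have w'_int: "integrable lborel w'"
    using W integrable_cong_AE[of W lebesgue w'] ae' w' integrable_completion[of w' lborel]
      measurable_completion[OF w'] borel_measurable_integrable[OF W] by blast
  have test': "(\<integral>x. w' x * \<phi> x \<partial>lborel) = 0" if "\<phi> \<in> test_functions \<Omega>" for \<phi>
  proof -
    have [measurable]: "\<phi> \<in> borel_measurable borel"
      using test_function_continuous[OF that] borel_measurable_continuous_onI by blast
    have "(\<integral>x. w' x * \<phi> x \<partial>lborel) = (\<integral>x. w' x * \<phi> x \<partial>lebesgue)"
      by (rule integral_completion[symmetric]) measurable
    also have "\<dots> = (\<integral>x. indicator \<Omega> x *\<^sub>R (w x * \<phi> x) \<partial>lebesgue)"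
    proof (rule integral_cong_AE)
      have [measurable]: "\<phi> \<in> borel_measurable lebesgue" by (rule measurable_completion) simp
      show "(\<lambda>x. w' x * \<phi> x) \<in> borel_measurable lebesgue" by (rule measurable_completion) measurable
      have "(\<lambda>x. W x * \<phi> x) \<in> borel_measurable lebesgue"
        using borel_measurable_integrable[OF W] by measurable
      then show "(\<lambda>x. indicator \<Omega> x *\<^sub>R (w x * \<phi> x)) \<in> borel_measurable lebesgue"
        by (simp add: W_def mult.assoc)
      show "AE x in lebesgue. w' x * \<phi> x = indicator \<Omega> x *\<^sub>R (w x * \<phi> x)"
        using ae' by eventually_elim (auto simp: W_def)
    qed
    also have "\<dots> = 0" using test[OF that] integral_restrict_space[OF \<Omega>(1)] by metis
    finally show ?thesis .
  qed
  have box: "(LINT x:box a b|lborel. w' x) = 0" if "cbox a b \<subseteq> \<Omega>" for a b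
  proof -
    have "(\<lambda>n. \<integral>x. w' x * box_bump a b n x \<partial>lborel) \<longlonglongrightarrow> (\<integral>x. w' x * indicator (box a b) x \<partial>lborel)"
    proof (rule integral_dominated_convergence)
      show "(\<lambda>x. w' x * box_bump a b n x) \<in> borel_measurable lborel" for n
        using borel_measurable_continuous_onI[OF test_function_continuous[OF box_bump_test_function[OF subset_UNIV]]]
        by measurable
      show "AE x in lborel. (\<lambda>n. w' x * box_bump a b n x) \<longlonglongrightarrow> w' x * indicator (box a b) x"
        by (intro AE_I2 tendsto_mult tendsto_const box_bump_tendsto_indicator)
      show "AE x in lborel. norm (w' x * box_bump a b n x) \<le> norm (w' x)" for n
        using box_bump_bounds[of a b n] by (auto simp: abs_mult intro!: mult_left_le)
    qed (use w'_int in auto)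
    then have "(\<integral>x. w' x * indicator (box a b) x \<partial>lborel) = 0"
      using test'[OF box_bump_test_function[OF that]] by (simp add: LIMSEQ_const_iff)
    then show ?thesis by (simp add: set_lebesgue_integral_def mult.commute)
  qed
  have cb: "AE x in lborel. x \<in> cbox a b \<longrightarrow> w' x = 0" if sub: "cbox a b \<subseteq> \<Omega>" for a b
  proof -
    \<comment> \<open>The restriction of \<open>w'\<close> to a box in the domain is integrated over arbitrary boxes.\<close>
    have eq: "(LINT x:box c d|lborel. indicator (box a b) x * w' x) = (LINT x:box c d \<inter> box a b|lborel. w' x)" for c d
      unfolding set_lebesgue_integral_def
      by (rule Bochner_Integration.integral_cong) (simp_all split: split_indicator)
    have "(LINT x:box c d|lborel. indicator (box a b) x * w' x) = 0" for c d
    proof -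
      obtain a' b' where ab: "box c d \<inter> box a b = box a' b'" unfolding box_Int_box by blast
      show ?thesis
      proof (cases "box a' b' = {}")
        case False
        have "cbox a' b' = closure (box a' b')" using False by simp
        also have "\<dots> \<subseteq> closure (cbox a b)" using ab box_subset_cbox by (intro closure_mono) blast
        finally show ?thesis using box[of a' b'] sub unfolding eq ab by auto
      qed (simp only: eq ab, simp add: set_lebesgue_integral_def)
    qed
    moreover have "integrable lborel (\<lambda>x. indicator (box a b) x * w' x)"
      using integrable_mult_indicator[of "box a b" lborel w'] w'_int by simp
    moreover have "(\<integral>x. indicator (box a b) x * w' x \<partial>lborel) = 0"
      using box[OF sub] by (simp add: set_lebesgue_integral_def)
    ultimately have 1: "AE x in lborel. indicator (box a b) x * w' x = 0"
      by (intro AE_eq_0_if_box_integrals_0)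
    have "cbox a b - box a b \<in> null_sets lborel"
      using negligible_frontier_interval[of a b] negligible_iff_null_sets[of "cbox a b - box a b"]
        null_sets_completion_iff[of "cbox a b - box a b" lborel] by simp
    then have "AE x in lborel. x \<notin> cbox a b - box a b" by (rule AE_not_in)
    with 1 show ?thesis by eventually_elim (auto simp: indicator_def split: if_splits)
  qed
  obtain \<D> where D: "countable \<D>" "\<And>X. X \<in> \<D> \<Longrightarrow> X \<subseteq> \<Omega> \<and> (\<exists>a b. X = cbox a b)" "\<Union>\<D> = \<Omega>"
    using open_countable_Union_open_cbox[OF \<open>open \<Omega>\<close>] by (metis Pow_iff image_iff subset_eq)
  have "AE x in lborel. \<forall>X\<in>\<D>. x \<in> X \<longrightarrow> w' x = 0"
    unfolding AE_ball_countable[OF D(1)] using D(2) cb by metis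
  then have "AE x in lborel. x \<in> \<Omega> \<longrightarrow> w' x = 0"
    using D(3) by (auto elim: eventually_mono)
  then have "AE x in lborel. x \<in> \<Omega> \<longrightarrow> w x = 0"
    using ae by eventually_elim (auto simp: W_def)
  then show ?thesis
    unfolding AE_restrict_space_iff[OF \<Omega>(1)] using AE_completion by blast
qed

section \<open>Change of variables under a shear\<close>

text \<open>
  Differentiability in one direction only, which is all that the volume change under a shear in this
  direction involves.
\<close>

definition dir_deriv :: "'a::real_normed_vector \<Rightarrow> ('a \<Rightarrow> real) \<Rightarrow> ('a \<Rightarrow> real) \<Rightarrow> bool"
  where "dir_deriv e F F' \<longleftrightarrow> (\<forall>x. ((\<lambda>s. F (x + s *\<^sub>R e)) has_real_derivative F' x) (at 0))"

lemma dir_derivD: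
  assumes "dir_deriv e F F'"
  shows "((\<lambda>s. F (x + s *\<^sub>R e)) has_real_derivative F' (x + s *\<^sub>R e)) (at s)"
proof -
  have "((\<lambda>r. F ((x + s *\<^sub>R e) + r *\<^sub>R e)) has_real_derivative F' (x + s *\<^sub>R e)) (at 0)"
    using assms by (auto simp: dir_deriv_def)
  then have "((\<lambda>r. F (x + (r + s) *\<^sub>R e)) has_real_derivative F' (x + s *\<^sub>R e)) (at 0)"
    by (simp add: algebra_simps)
  then show ?thesis using DERIV_shift[of "\<lambda>r. F (x + r *\<^sub>R e)" "F' (x + s *\<^sub>R e)" 0 s] by simp
qed

lemma dir_deriv_partial:
  assumes "f differentiable_on UNIV"
  shows "dir_deriv (axis j 1) f (partial j f)"
  unfolding dir_deriv_def
proof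
  fix x
  have f: "(f has_derivative frechet_derivative f (at x)) (at x)"
    using assms by (auto simp: differentiable_on_def frechet_derivative_works)
  have "((\<lambda>s. f (x + s *\<^sub>R axis j 1)) has_derivative
      (\<lambda>s. frechet_derivative f (at x) (s *\<^sub>R axis j 1))) (at 0)"
    by (rule has_derivative_compose[of "\<lambda>s. x + s *\<^sub>R axis j 1" "\<lambda>s. s *\<^sub>R axis j 1" 0 UNIV f])
       (auto intro!: derivative_eq_intros f)
  then show "((\<lambda>s. f (x + s *\<^sub>R axis j 1)) has_real_derivative partial j f x) (at 0)"
    using linear_scale[OF has_derivative_linear[OF f]]
    by (simp add: has_field_derivative_def partial_def mult_commute_abs)
qed

lemma dir_deriv_outside_support:
  assumes "dir_deriv e F F'" "closed K" "\<And>x. x \<notin> K \<Longrightarrow> F x = 0" "x \<notin> K"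
  shows "F' x = 0"
proof -
  have "open ((\<lambda>s::real. x + s *\<^sub>R e) -` (- K))"
    using assms(2) by (intro open_vimage continuous_intros) auto
  then have "eventually (\<lambda>s::real. x + s *\<^sub>R e \<in> - K) (nhds 0)"
    using eventually_nhds_in_open[of "(\<lambda>s::real. x + s *\<^sub>R e) -` (- K)" 0] assms(4) by simp
  then have "eventually (\<lambda>s. F (x + s *\<^sub>R e) = 0) (nhds 0)"
    by eventually_elim (use assms(3) in auto)
  moreover have "((\<lambda>s. F (x + s *\<^sub>R e)) has_real_derivative F' x) (at 0)"
    using assms(1) by (simp add: dir_deriv_def)
  ultimately have "((\<lambda>s. 0) has_real_derivative F' x) (at (0::real))"
    using DERIV_cong_ev[of 0 0 "\<lambda>s. F (x + s *\<^sub>R e)" "\<lambda>s. 0" "F' x" "F' x"] by simp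
  then show ?thesis using DERIV_unique DERIV_const by blast
qed

lemma continuous_compact_support_integral:
  fixes f :: "'a::euclidean_space \<Rightarrow> real"
  assumes "continuous_on UNIV f" "\<And>x. x \<notin> cbox a b \<Longrightarrow> f x = 0"
  shows "integrable lborel f" "f integrable_on cbox a b" "integral\<^sup>L lborel f = integral (cbox a b) f"
proof -
  have c: "continuous_on (cbox a b) f" using assms(1) continuous_on_subset by blast
  have f: "(\<lambda>x. indicator (cbox a b) x *\<^sub>R f x) = f" using assms(2) by (auto simp: fun_eq_iff indicator_def)
  have "set_integrable lborel (cbox a b) f"
    unfolding set_integrable_def using borel_integrable_compact[OF compact_cbox c]
    by (simp add: indicator_scaleR_eq_if)
  then show "integrable lborel f" "f integrable_on cbox a b" "integral\<^sup>L lborel f = integral (cbox a b) f"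
    using set_borel_integral_eq_integral[of "cbox a b" f] f
    by (simp_all add: set_integrable_def set_lebesgue_integral_def)
qed

text \<open>
  The integral of a difference quotient of $F$ vanishes by translation invariance, and difference
  quotients are dominated by the maximum of $|F'|$ on a bounded set.
\<close>

lemma integral_dir_deriv_eq_0:
  fixes F F' :: "'a::euclidean_space \<Rightarrow> real"
  assumes d: "dir_deriv e F F'" and cF: "continuous_on UNIV F" and cF': "continuous_on UNIV F'"
    and K: "compact K" "\<And>x. x \<notin> K \<Longrightarrow> F x = 0"
  shows "integral\<^sup>L lborel F' = 0"
proof -
  have F'0: "F' x = 0" if "x \<notin> K" for x
    using dir_deriv_outside_support[OF d compact_imp_closed[OF K(1)] K(2)] that by blast
  obtain B where B: "\<And>x. \<bar>F' x\<bar> \<le> B"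
  proof -
    have "bounded (F' ` K)"
      using compact_continuous_image[OF continuous_on_subset[OF cF'] K(1)] compact_imp_bounded by blast
    then obtain B where "B > 0" "\<And>x. x \<in> K \<Longrightarrow> \<bar>F' x\<bar> \<le> B" by (auto simp: bounded_pos)
    then show ?thesis using F'0 that[of B] by (metis abs_zero less_imp_le)
  qed
  obtain r where r: "\<And>x. x \<in> K \<Longrightarrow> norm x \<le> r"
    using compact_imp_bounded[OF K(1)] by (auto simp: bounded_iff)
  define C where "C = cball (0::'a) (r + norm e)"
  define Q where "Q n x = real (Suc n) * (F (x + inverse (real (Suc n)) *\<^sub>R e) - F x)" for n x
  have [measurable]: "F \<in> borel_measurable borel" "F' \<in> borel_measurable borel"
    using cF cF' borel_measurable_continuous_onI by blast+
  have Fint: "integrable lborel F"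
  proof -
    obtain a where "K \<subseteq> cbox (-a) a" using bounded_subset_cbox_symmetric compact_imp_bounded K(1) by metis
    then show ?thesis using continuous_compact_support_integral(1)[OF cF, of "-a" a] K(2) by blast
  qed
  have "(\<lambda>n. integral\<^sup>L lborel (Q n)) \<longlonglongrightarrow> integral\<^sup>L lborel F'"
  proof (rule integral_dominated_convergence)
    show "Q n \<in> borel_measurable lborel" for n unfolding Q_def by measurable
    show "integrable lborel (\<lambda>x. indicator C x * B)"
      unfolding C_def by (intro integrable_mult_left integrable_real_indicator) (use emeasure_bounded_finite[OF bounded_cball] in auto)
    have "(\<lambda>n. Q n x) \<longlonglongrightarrow> F' x" for x
    proof -
      have "((\<lambda>s. (F (x + (0 + s) *\<^sub>R e) - F (x + 0 *\<^sub>R e)) / s) \<longlongrightarrow> F' x) (at 0)"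
        using d by (auto simp: dir_deriv_def DERIV_def)
      then have "(\<lambda>n. (F (x + (0 + inverse (real (Suc n))) *\<^sub>R e) - F (x + 0 *\<^sub>R e)) / inverse (real (Suc n)))
          \<longlonglongrightarrow> F' x"
        by (rule filterlim_compose)
           (auto simp: filterlim_at intro!: LIMSEQ_inverse_real_of_nat simp del: of_nat_Suc)
      then show ?thesis by (simp add: Q_def divide_inverse mult.commute)
    qed
    then show "AE x in lborel. (\<lambda>n. Q n x) \<longlonglongrightarrow> F' x" by simp
    have "norm (Q n x) \<le> indicator C x * B" for n x
    proof (cases "x \<in> C")
      case True
      have "\<exists>z>0. z < inverse (real (Suc n)) \<and> F (x + inverse (real (Suc n)) *\<^sub>R e) - F (x + 0 *\<^sub>R e)
         = (inverse (real (Suc n)) - 0) * F' (x + z *\<^sub>R e)"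
        by (rule MVT2[of 0 "inverse (real (Suc n))" "\<lambda>s. F (x + s *\<^sub>R e)" "\<lambda>s. F' (x + s *\<^sub>R e)"])
           (auto intro: dir_derivD[OF d])
      then obtain z where "F (x + inverse (real (Suc n)) *\<^sub>R e) - F x = inverse (real (Suc n)) * F' (x + z *\<^sub>R e)"
        by auto
      then have "Q n x = F' (x + z *\<^sub>R e)" by (simp add: Q_def field_simps)
      then show ?thesis using B True by simp
    next
      case False
      then have n: "norm x > r + norm e" by (simp add: C_def)
      then have "x \<notin> K" using r by (meson add_increasing2 less_le_not_le linorder_not_le norm_ge_zero order_trans)
      moreover have "norm (inverse (real (Suc n)) *\<^sub>R e) \<le> norm e"
        using mult_right_mono[of "inverse (real (Suc n))" 1 "norm e"] by (simp add: field_simps)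
      then have "norm (x + inverse (real (Suc n)) *\<^sub>R e) > r"
        using n norm_diff_ineq[of x "inverse (real (Suc n)) *\<^sub>R e"] by linarith
      then have "x + inverse (real (Suc n)) *\<^sub>R e \<notin> K" using r not_less by blast
      ultimately show ?thesis using K(2) False by (simp add: Q_def)
    qed
    then show "AE x in lborel. norm (Q n x) \<le> indicator C x * B" for n by simp
  qed simp
  moreover have "integral\<^sup>L lborel (Q n) = 0" for n
  proof -
    define c where "c = inverse (real (Suc n)) *\<^sub>R e"
    have L: "lborel = distr lborel borel (\<lambda>x. c + x)" by (simp add: lborel_distr_plus)
    have "integral\<^sup>L lborel F = integral\<^sup>L (distr lborel borel (\<lambda>x. c + x)) F" using L by simp
    also have "\<dots> = (\<integral>x. F (c + x) \<partial>lborel)" by (rule integral_distr) measurable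
    finally have 1: "(\<integral>x. F (x + c) \<partial>lborel) = integral\<^sup>L lborel F" by (simp add: add.commute)
    have "integrable (distr lborel borel (\<lambda>x. c + x)) F" using Fint L by simp
    then have "integrable lborel (\<lambda>x. F (x + c))"
      by (subst (asm) integrable_distr_eq) (auto simp: add.commute)
    then show ?thesis using Fint 1 unfolding Q_def c_def[symmetric] by simp
  qed
  ultimately show ?thesis by (simp add: LIMSEQ_const_iff)
qed

text \<open>
  The derivative of the integrand with respect to $h$ is the derivative in direction $e$ of
  $x \mapsto \phi(x + h\, w(x)\, e)\, w(x)$, which is supported in $K$. So the integral does not
  depend on $h$, and $h = 0$ gives the right-hand side.
\<close>

lemma shear_integral_test:
  fixes \<phi> \<phi>' w w' :: "'a::euclidean_space \<Rightarrow> real"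
  assumes dw: "dir_deriv e w w'" and cw: "continuous_on UNIV w" and cw': "continuous_on UNIV w'"
    and K: "compact K" "\<And>x. x \<notin> K \<Longrightarrow> w x = 0"
    and d\<phi>: "dir_deriv e \<phi> \<phi>'" and c\<phi>: "continuous_on UNIV \<phi>" and c\<phi>': "continuous_on UNIV \<phi>'"
    and L: "bounded L" "\<And>x. x \<notin> L \<Longrightarrow> \<phi> x = 0"
  shows "(\<integral>x. \<phi> (x + (h * w x) *\<^sub>R e) * (1 + h * w' x) \<partial>lborel) = integral\<^sup>L lborel \<phi>"
proof -
  define G where "G s x = \<phi> (x + (s * w x) *\<^sub>R e) * (1 + s * w' x)" for s x
  define G' where "G' s x = \<phi>' (x + (s * w x) *\<^sub>R e) * w x * (1 + s * w' x) + \<phi> (x + (s * w x) *\<^sub>R e) * w' x" for s x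
  have w'0: "w' x = 0" if "x \<notin> K" for x
    using dir_deriv_outside_support[OF dw compact_imp_closed[OF K(1)] K(2)] that by blast
  obtain a where C: "K \<union> L \<subseteq> cbox (-a) a"
    using bounded_subset_cbox_symmetric[of "K \<union> L"] compact_imp_bounded K(1) L(1) by auto
  have G0: "G s x = 0" "G' s x = 0" if "x \<notin> cbox (-a) a" for s x
  proof -
    have "w x = 0" "w' x = 0" "\<phi> x = 0" using that C K(2) L(2) w'0 by blast+
    then show "G s x = 0" "G' s x = 0" by (simp_all add: G_def G'_def)
  qed
  note cont = continuous_on_compose2[OF c\<phi>] continuous_on_compose2[OF c\<phi>']
      continuous_on_compose2[OF cw] continuous_on_compose2[OF cw']
  have cG: "continuous_on UNIV (G s)" "continuous_on UNIV (G' s)" for s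
    unfolding G_def G'_def by (auto intro!: continuous_intros cont)
  have G'int: "integral (cbox (-a) a) (G' s) = 0" for s
  proof -
    define P where "P x = \<phi> (x + (s * w x) *\<^sub>R e) * w x" for x
    have "dir_deriv e P (G' s)"
      unfolding dir_deriv_def
    proof
      fix x
      have 1: "((\<lambda>r. w (x + r *\<^sub>R e)) has_real_derivative w' x) (at 0)"
        using dw by (simp add: dir_deriv_def)
      have 2: "((\<lambda>r. \<phi> (x + (r + s * w (x + r *\<^sub>R e)) *\<^sub>R e)) has_real_derivative
          \<phi>' (x + (s * w x) *\<^sub>R e) * (1 + s * w' x)) (at 0)"
        by (rule DERIV_chain2[of "\<lambda>r. \<phi> (x + r *\<^sub>R e)" _ "\<lambda>r. r + s * w (x + r *\<^sub>R e)"])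
           (use dir_derivD[OF d\<phi>, of x "s * w x"] in \<open>auto intro!: derivative_eq_intros 1\<close>)
      have "((\<lambda>r. \<phi> (x + (r + s * w (x + r *\<^sub>R e)) *\<^sub>R e) * w (x + r *\<^sub>R e)) has_real_derivative G' s x) (at 0)"
        by (rule derivative_eq_intros 1 2 refl)+ (simp add: G'_def algebra_simps)
      then show "((\<lambda>r. P (x + r *\<^sub>R e)) has_real_derivative G' s x) (at 0)"
        by (simp add: P_def algebra_simps)
    qed
    moreover have "continuous_on UNIV P" unfolding P_def by (auto intro!: continuous_intros cont)
    moreover have "P x = 0" if "x \<notin> K" for x using K(2) that by (simp add: P_def)
    ultimately have "integral\<^sup>L lborel (G' s) = 0"
      using integral_dir_deriv_eq_0[OF _ _ cG(2) K(1)] by blast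
    then show ?thesis using continuous_compact_support_integral(3)[OF cG(2) G0(2)] by metis
  qed
  have "((\<lambda>s. integral (cbox (-a) a) (G s)) has_real_derivative integral (cbox (-a) a) (G' s)) (at s within UNIV)" for s
  proof (rule leibniz_rule_field_derivative)
    show "((\<lambda>s. G s x) has_real_derivative G' s x) (at s within UNIV)" for s x
      unfolding G_def G'_def
      by (rule derivative_eq_intros refl DERIV_chain2[OF dir_derivD[OF d\<phi>]])+ (simp add: algebra_simps)
    show "G s integrable_on cbox (-a) a" for s
      using continuous_compact_support_integral(2)[OF cG(1) G0(1)] .
    show "continuous_on (UNIV \<times> cbox (-a) a) (\<lambda>(s, x). G' s x)"
      unfolding G'_def split_beta by (auto intro!: continuous_intros cont)
  qed auto
  then have "integral (cbox (-a) a) (G h) = integral (cbox (-a) a) (G 0)"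
    using G'int DERIV_isconst_all[of "\<lambda>s. integral (cbox (-a) a) (G s)" h 0] by simp
  then have "integral\<^sup>L lborel (G h) = integral\<^sup>L lborel (G 0)"
    using continuous_compact_support_integral(3)[OF cG(1) G0(1)] by metis
  then show ?thesis by (simp add: G_def[abs_def])
qed

text \<open>
  The Jacobian determinant of a shear is $1 + h\, w'$. Lebesgue measure is determined by its values on
  boxes, and indicators of boxes are limits of bump functions.
\<close>

lemma shear_change_of_variables:
  fixes w w' :: "real^'d \<Rightarrow> real"
  assumes dw: "dir_deriv (axis j 1) w w'" and cw: "continuous_on UNIV w" and cw': "continuous_on UNIV w'"
    and K: "compact K" "\<And>x. x \<notin> K \<Longrightarrow> w x = 0"
    and J: "\<And>x. \<bar>h * w' x\<bar> \<le> 1"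
  shows "lborel = distr (density lborel (\<lambda>x. ennreal (1 + h * w' x))) borel (\<lambda>x. x + (h * w x) *\<^sub>R axis j 1)"
proof (rule lborel_eqI)
  define S where "S x = x + (h * w x) *\<^sub>R axis j 1" for x
  have [measurable]: "w \<in> borel_measurable borel" "w' \<in> borel_measurable borel"
    using cw cw' borel_measurable_continuous_onI by auto
  have [measurable]: "S \<in> borel_measurable borel" unfolding S_def[abs_def] by measurable
  have J2: "0 \<le> 1 + h * w' x" "1 + h * w' x \<le> 2" for x using J[of x] by linarith+
  fix l u :: "real^'d"
  assume lu: "\<And>b. b \<in> Basis \<Longrightarrow> l \<bullet> b \<le> u \<bullet> b"
  define \<beta> where "\<beta> n = box_bump l u n" for n
  have \<beta>: "\<beta> n \<in> test_functions UNIV" for n by (simp add: \<beta>_def box_bump_test_function)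
  then have c\<beta>: "continuous_on UNIV (\<beta> n)" for n using test_function_continuous by blast
  have [measurable]: "\<beta> n \<in> borel_measurable borel" for n using c\<beta> borel_measurable_continuous_onI by blast
  have eq: "(\<integral>x. \<beta> n (S x) * (1 + h * w' x) \<partial>lborel) = integral\<^sup>L lborel (\<beta> n)" for n
  proof -
    have "C_k_on (Suc 0) (\<beta> n) UNIV" using \<beta> by (auto simp: test_functions_def)
    then have "\<beta> n differentiable_on UNIV" "continuous_on UNIV (partial j (\<beta> n))" by auto
    moreover have "\<beta> n x = 0" if "x \<notin> box l u" for x using box_bump_eq_0 that by (simp add: \<beta>_def)
    ultimately show ?thesis unfolding S_def
      by (intro shear_integral_test[OF dw cw cw' K dir_deriv_partial c\<beta> _ bounded_box])
  qed
  obtain a where a: "K \<union> box l u \<subseteq> cbox (-a) a"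
    using bounded_subset_cbox_symmetric[of "K \<union> box l u"] compact_imp_bounded K(1) by auto
  define C where "C = cbox (-a) a"
  have C: "bounded C" "K \<union> box l u \<subseteq> C" "C \<in> sets borel" using a by (simp_all add: C_def)
  note [measurable] = C(3)
  have SC: "S x \<notin> box l u" if "x \<notin> C" for x
  proof -
    have "x \<notin> K" "x \<notin> box l u" using that C(2) by blast+
    then show ?thesis using K(2) by (simp add: S_def)
  qed
  have Cint: "integrable lborel (\<lambda>x. indicator C x * 2 :: real)"
    using C emeasure_bounded_finite[OF C(1)] by (intro integrable_mult_left integrable_real_indicator) auto
  have "(\<lambda>n. \<integral>x. \<beta> n (S x) * (1 + h * w' x) \<partial>lborel) \<longlonglongrightarrow>
      (\<integral>x. indicator (box l u) (S x) * (1 + h * w' x) \<partial>lborel)"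
  proof (rule integral_dominated_convergence)
    show "AE x in lborel. (\<lambda>n. \<beta> n (S x) * (1 + h * w' x)) \<longlonglongrightarrow> indicator (box l u) (S x) * (1 + h * w' x)"
      unfolding \<beta>_def by (intro AE_I2 tendsto_intros box_bump_tendsto_indicator)
    have "norm (\<beta> n (S x) * (1 + h * w' x)) \<le> indicator C x * 2" for n x
    proof (cases "x \<in> C")
      case True
      have "\<beta> n (S x) * (1 + h * w' x) \<le> 1 * 2"
        using box_bump_bounds[of l u n "S x"] J2[of x] unfolding \<beta>_def by (intro mult_mono) auto
      moreover have "0 \<le> \<beta> n (S x) * (1 + h * w' x)"
        using box_bump_bounds[of l u n "S x"] J2[of x] unfolding \<beta>_def by (intro mult_nonneg_nonneg)
      ultimately show ?thesis using True by simp
    next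
      case False
      then show ?thesis using SC[OF False] box_bump_eq_0[of "S x" l u n] by (simp add: \<beta>_def)
    qed
    then show "AE x in lborel. norm (\<beta> n (S x) * (1 + h * w' x)) \<le> indicator C x * 2" for n by simp
  qed (use Cint in auto)
  moreover have "(\<lambda>n. integral\<^sup>L lborel (\<beta> n)) \<longlonglongrightarrow> (\<integral>x. indicator (box l u) x \<partial>lborel)"
  proof (rule integral_dominated_convergence)
    show "AE x in lborel. (\<lambda>n. \<beta> n x) \<longlonglongrightarrow> indicator (box l u) x"
      unfolding \<beta>_def by (intro AE_I2 box_bump_tendsto_indicator)
    have "norm (\<beta> n x) \<le> indicator C x * 2" for n x
    proof (cases "x \<in> C")
      case True
      then show ?thesis using box_bump_bounds[of l u n x] by (simp add: \<beta>_def)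
    next
      case False
      then have "x \<notin> box l u" using C(2) by blast
      then show ?thesis using box_bump_eq_0[of x l u n] by (simp add: \<beta>_def)
    qed
    then show "AE x in lborel. norm (\<beta> n x) \<le> indicator C x * 2" for n by simp
  qed (use Cint in auto)
  ultimately have I: "(\<integral>x. indicator (box l u) (S x) * (1 + h * w' x) \<partial>lborel) = measure lborel (box l u)"
    using eq LIMSEQ_unique by simp
  have "integrable lborel (\<lambda>x. indicator (box l u) (S x) * (1 + h * w' x))"
  proof (rule Bochner_Integration.integrable_bound[OF Cint])
    have "norm (indicator (box l u) (S x) * (1 + h * w' x)) \<le> norm (indicator C x * 2 :: real)" for x
      using SC[of x] J2[of x] by (cases "x \<in> C"; cases "S x \<in> box l u") simp_all
    then show "AE x in lborel. norm (indicator (box l u) (S x) * (1 + h * w' x)) \<le> norm (indicator C x * 2 :: real)"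
      by simp
  qed measurable
  then have "(\<integral>\<^sup>+x. ennreal (indicator (box l u) (S x) * (1 + h * w' x)) \<partial>lborel) = ennreal (measure lborel (box l u))"
    using J2 I by (subst nn_integral_eq_integral) auto
  moreover have "emeasure (distr (density lborel (\<lambda>x. ennreal (1 + h * w' x))) borel S) (box l u)
     = (\<integral>\<^sup>+x. ennreal (indicator (box l u) (S x) * (1 + h * w' x)) \<partial>lborel)"
  proof -
    have "S -` box l u \<in> sets borel" using measurable_sets[of S borel borel "box l u"] by simp
    then have "emeasure (distr (density lborel (\<lambda>x. ennreal (1 + h * w' x))) borel S) (box l u)
        = (\<integral>\<^sup>+x. ennreal (1 + h * w' x) * indicator (S -` box l u) x \<partial>lborel)"
      by (simp add: emeasure_distr emeasure_density)
    also have "\<dots> = (\<integral>\<^sup>+x. ennreal (indicator (box l u) (S x) * (1 + h * w' x)) \<partial>lborel)"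
      by (rule nn_integral_cong) (simp split: split_indicator)
    finally show ?thesis .
  qed
  moreover have "ennreal (measure lborel (box l u)) = ennreal (\<Prod>b\<in>Basis. (u - l) \<bullet> b)"
    using emeasure_eq_ennreal_measure[of lborel "box l u"] emeasure_lborel_box[OF lu] by simp
  ultimately show "emeasure (distr (density lborel (\<lambda>x. ennreal (1 + h * w' x))) borel
      (\<lambda>x. x + (h * w x) *\<^sub>R axis j 1)) (box l u) = ennreal (\<Prod>b\<in>Basis. (u - l) \<bullet> b)"
    unfolding S_def by simp
qed simp

lemma shear_integral:
  fixes w w' f :: "real^'d \<Rightarrow> real"
  assumes dw: "dir_deriv (axis j 1) w w'" and cw: "continuous_on UNIV w" and cw': "continuous_on UNIV w'"
    and K: "compact K" "\<And>x. x \<notin> K \<Longrightarrow> w x = 0"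
    and J: "\<And>x. \<bar>h * w' x\<bar> \<le> 1" and [measurable]: "f \<in> borel_measurable borel"
  shows "(\<integral>x. f (x + (h * w x) *\<^sub>R axis j 1) * (1 + h * w' x) \<partial>lborel) = integral\<^sup>L lborel f"
proof -
  have [measurable]: "w \<in> borel_measurable borel" "w' \<in> borel_measurable borel"
    using cw cw' borel_measurable_continuous_onI by auto
  have "integral\<^sup>L lborel f = integral\<^sup>L (distr (density lborel (\<lambda>x. ennreal (1 + h * w' x))) borel
      (\<lambda>x. x + (h * w x) *\<^sub>R axis j 1)) f"
    using shear_change_of_variables[OF dw cw cw' K J] by simp
  also have "\<dots> = (\<integral>x. f (x + (h * w x) *\<^sub>R axis j 1) \<partial>density lborel (\<lambda>x. ennreal (1 + h * w' x)))"
    by (rule integral_distr) auto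
  also have "\<dots> = (\<integral>x. (1 + h * w' x) *\<^sub>R f (x + (h * w x) *\<^sub>R axis j 1) \<partial>lborel)"
  proof (rule integral_density)
    have "0 \<le> 1 + h * w' x" for x using J[of x] by linarith
    then show "AE x in lborel. 0 \<le> 1 + h * w' x" by simp
    show "(\<lambda>x. f (x + (h * w x) *\<^sub>R axis j 1)) \<in> borel_measurable lborel"
      "(\<lambda>x. 1 + h * w' x) \<in> borel_measurable lborel" by measurable
  qed
  finally show ?thesis by (simp add: mult.commute)
qed

section \<open>Integral curves of Lipschitz vector fields\<close>

text \<open>
  Curves are parametrised by the unit interval because trajectories are. The lemmas below assume
  that the field has Lipschitz constant $1/2$: then the Picard map is already a contraction on the
  unit interval, and multiplying a field by a small constant reduces everything to this case.
\<close>

definition integral_curve :: "('a::real_normed_vector \<Rightarrow> 'a) \<Rightarrow> (real \<Rightarrow> 'a) \<Rightarrow> bool"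
  where "integral_curve v \<gamma> \<longleftrightarrow>
    (\<forall>t\<in>{0..1}. (\<gamma> has_vector_derivative v (\<gamma> t)) (at t within {0..1}))"

lemma norm_diff_le_if_vector_derivative_le:
  assumes "convex S" "\<And>t. t \<in> S \<Longrightarrow> (f has_vector_derivative f' t) (at t within S)"
    and "\<And>t. t \<in> S \<Longrightarrow> norm (f' t) \<le> B" "s \<in> S" "t \<in> S"
  shows "norm (f t - f s) \<le> B * \<bar>t - s\<bar>"
proof -
  have "onorm (\<lambda>h. h *\<^sub>R f' r) \<le> B" if "r \<in> S" for r
    using assms(3)[OF that] onorm_scaleR_left[OF bounded_linear_ident, of "f' r"]
    by (simp add: onorm_id)
  then show ?thesis
    using differentiable_bound[OF assms(1), of f "\<lambda>r h. h *\<^sub>R f' r" B s t] assms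
    by (auto simp: has_vector_derivative_def norm_minus_commute abs_minus_commute)
qed

lemma integral_curve_continuous: "integral_curve v \<gamma> \<Longrightarrow> continuous_on {0..1} \<gamma>"
  unfolding integral_curve_def
  by (meson continuous_on_eq_continuous_within has_vector_derivative_continuous)

text \<open>
  At a time $r$ where the distance $D$ of the two curves is maximal, the mean value inequality gives
  $D \le |\gamma(s) - \eta(s)| + D/2$. This is uniqueness and continuous dependence in one, for
  initial conditions at any time $s$.
\<close>

lemma integral_curves_close:
  fixes v :: "'a::real_normed_vector \<Rightarrow> 'a"
  assumes lip: "\<And>x y. norm (v x - v y) \<le> 1 / 2 * norm (x - y)"
    and g: "integral_curve v \<gamma>" and e: "integral_curve v \<eta>"
    and s: "s \<in> {0..1}" and t: "t \<in> {0..1}"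
  shows "norm (\<gamma> t - \<eta> t) \<le> 2 * norm (\<gamma> s - \<eta> s)"
proof -
  define f where "f t = \<gamma> t - \<eta> t" for t
  have "continuous_on {0..1} (\<lambda>t. norm (f t))"
    unfolding f_def by (intro continuous_intros integral_curve_continuous[OF g] integral_curve_continuous[OF e])
  then obtain r where r: "r \<in> {0..1}" "\<And>t. t \<in> {0..1} \<Longrightarrow> norm (f t) \<le> norm (f r)"
    using continuous_attains_sup[of "{0..1::real}" "\<lambda>t. norm (f t)"] by auto
  have "norm (f r - f s) \<le> 1 / 2 * norm (f r) * \<bar>r - s\<bar>"
  proof (rule norm_diff_le_if_vector_derivative_le[of "{0..1}" f "\<lambda>t. v (\<gamma> t) - v (\<eta> t)"])
    show "(f has_vector_derivative v (\<gamma> t) - v (\<eta> t)) (at t within {0..1})" if "t \<in> {0..1}" for t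
      unfolding f_def using g e that by (auto simp: integral_curve_def intro: has_vector_derivative_diff)
    show "norm (v (\<gamma> t) - v (\<eta> t)) \<le> 1 / 2 * norm (f r)" if "t \<in> {0..1}" for t
      using lip[of "\<gamma> t" "\<eta> t"] r(2)[OF that] by (simp add: f_def)
  qed (use r s in auto)
  also have "\<dots> \<le> 1 / 2 * norm (f r) * 1" using r(1) s by (intro mult_left_mono) auto
  finally have "norm (f r) \<le> 2 * norm (f s)"
    using norm_triangle_sub[of "f r" "f s"] by linarith
  then show ?thesis using r(2)[OF t] by (simp add: f_def)
qed

text \<open>
  Banach's fixed point theorem for the Picard map. To have bounded continuous functions on the whole
  line, the time is clamped to the unit interval.
\<close>

lemma integral_curve_exists:
  fixes v :: "'a::euclidean_space \<Rightarrow> 'a"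
  assumes lip: "\<And>x y. norm (v x - v y) \<le> 1 / 2 * norm (x - y)"
  obtains \<gamma> where "integral_curve v \<gamma>" "\<gamma> 0 = x"
proof -
  define c :: "real \<Rightarrow> real" where "c t = max 0 (min 1 t)" for t
  have c: "c t \<in> {0..1}" for t by (auto simp: c_def)
  have cc: "continuous_on UNIV c" unfolding c_def by (intro continuous_intros)
  have "lipschitz_on (1/2) UNIV v"
    by (rule lipschitz_onI) (use lip in \<open>auto simp: dist_norm\<close>)
  then have cv: "continuous_on UNIV v" by (rule lipschitz_on_continuous_on)
  define F where "F \<gamma> t = x + integral {0..t} (\<lambda>s. v (apply_bcontfun \<gamma> s))"
    for \<gamma> :: "real \<Rightarrow>\<^sub>C 'a" and t
  have vg: "continuous_on S (\<lambda>s. v (apply_bcontfun \<gamma> s))" for \<gamma> :: "real \<Rightarrow>\<^sub>C 'a" and S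
    by (intro continuous_on_compose2[OF cv] continuous_on_apply_bcontfun continuous_on_subset[OF _ subset_UNIV]) auto
  have int: "(\<lambda>s. v (apply_bcontfun \<gamma> s)) integrable_on {a..b}" for \<gamma> :: "real \<Rightarrow>\<^sub>C 'a" and a b
    by (rule integrable_continuous_real[OF vg])
  have FD: "(F \<gamma> has_vector_derivative v (apply_bcontfun \<gamma> t)) (at t within {0..1})" if "t \<in> {0..1}" for \<gamma> t
  proof -
    have *: "((\<lambda>t. integral {0..t} (\<lambda>s. v (apply_bcontfun \<gamma> s))) has_vector_derivative v (apply_bcontfun \<gamma> t)) (at t within {0..1})"
      by (rule integral_has_vector_derivative[OF vg that])
    show ?thesis unfolding F_def
      using has_vector_derivative_add[OF has_vector_derivative_const *] by simp
  qed
  have Fc: "continuous_on {0..1} (F \<gamma>)" for \<gamma>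
    using FD by (meson continuous_on_eq_continuous_within has_vector_derivative_continuous)
  have bc: "(\<lambda>t. F \<gamma> (c t)) \<in> bcontfun" for \<gamma>
  proof -
    have "bounded (F \<gamma> ` {0..1})" using compact_continuous_image[OF Fc] compact_imp_bounded by auto
    then obtain b where b: "\<And>t. t \<in> {0..1} \<Longrightarrow> norm (F \<gamma> t) \<le> b"
      unfolding bounded_iff by blast
    have "continuous_on UNIV (\<lambda>t. F \<gamma> (c t))"
      using continuous_on_compose2[OF Fc cc, of \<gamma>] c by blast
    then show ?thesis using b[OF c] by (rule bcontfun_normI)
  qed
  define T where "T \<gamma> = Bcontfun (\<lambda>t. F \<gamma> (c t))" for \<gamma>
  have T: "apply_bcontfun (T \<gamma>) t = F \<gamma> (c t)" for \<gamma> t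
    unfolding T_def using Bcontfun_inverse[OF bc] by simp
  have "dist (T \<gamma>) (T \<eta>) \<le> 1 / 2 * dist \<gamma> \<eta>" for \<gamma> \<eta>
  proof (rule dist_bound)
    fix t
    have "F \<gamma> (c t) - F \<eta> (c t) = integral {0..c t} (\<lambda>s. v (apply_bcontfun \<gamma> s) - v (apply_bcontfun \<eta> s))"
      unfolding F_def by (simp add: integral_diff int)
    also have "norm \<dots> \<le> 1 / 2 * dist \<gamma> \<eta> * (c t - 0)"
    proof (rule integral_bound)
      show "norm (v (apply_bcontfun \<gamma> s) - v (apply_bcontfun \<eta> s)) \<le> 1 / 2 * dist \<gamma> \<eta>" for s
        using lip[of "apply_bcontfun \<gamma> s" "apply_bcontfun \<eta> s"] dist_bounded[of \<gamma> s \<eta>] by (simp add: dist_norm)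
    qed (use c in \<open>auto intro!: continuous_intros vg\<close>)
    also have "\<dots> \<le> 1 / 2 * dist \<gamma> \<eta> * 1" using c[of t] by (intro mult_left_mono) auto
    finally show "dist (apply_bcontfun (T \<gamma>) t) (apply_bcontfun (T \<eta>) t) \<le> 1 / 2 * dist \<gamma> \<eta>"
      by (simp add: T dist_norm)
  qed
  then obtain \<gamma> where \<gamma>: "T \<gamma> = \<gamma>" using banach_fix_type[of "1/2" T] by auto
  have "apply_bcontfun \<gamma> t = F \<gamma> t" if "t \<in> {0..1}" for t
  proof -
    have "c t = t" using that by (auto simp: c_def)
    then show ?thesis using T[of \<gamma> t] unfolding \<gamma> by simp
  qed
  then have eq: "\<And>t. t \<in> {0..1} \<Longrightarrow> F \<gamma> t = apply_bcontfun \<gamma> t" by simp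
  have "integral_curve v (F \<gamma>)" unfolding integral_curve_def using FD eq by auto
  moreover have "F \<gamma> 0 = x" by (simp add: F_def)
  ultimately show ?thesis using that by blast
qed

text \<open>
  A curve that meets a zero of the field agrees with the constant curve.
\<close>

lemma integral_curve_stationary:
  assumes "\<And>x y. norm (v x - v y) \<le> 1 / 2 * norm (x - y)"
    and "integral_curve v \<gamma>" "s \<in> {0..1}" "v (\<gamma> s) = 0" "t \<in> {0..1}"
  shows "\<gamma> t = \<gamma> s"
proof -
  have "integral_curve v (\<lambda>t. \<gamma> s)" using assms(4) by (auto simp: integral_curve_def)
  then show ?thesis using integral_curves_close[OF assms(1,2), of "\<lambda>t. \<gamma> s" s t] assms(3,5) by simp
qed

lemma integral_curve_euler_step:
  fixes v :: "'a::real_normed_vector \<Rightarrow> 'a"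
  assumes lip: "\<And>x y. norm (v x - v y) \<le> 1 / 2 * norm (x - y)" and M: "\<And>x. norm (v x) \<le> M"
    and g: "integral_curve v \<gamma>" and t: "0 \<le> t" "0 \<le> h" "t + h \<le> 1"
  shows "norm (\<gamma> (t + h) - \<gamma> t - h *\<^sub>R v (\<gamma> t)) \<le> M / 2 * h\<^sup>2"
proof -
  define f where "f s = \<gamma> s - s *\<^sub>R v (\<gamma> t)" for s
  have D: "(\<gamma> has_vector_derivative v (\<gamma> s)) (at s within {t..t+h})" if "s \<in> {t..t+h}" for s
  proof (rule has_vector_derivative_within_subset)
    show "(\<gamma> has_vector_derivative v (\<gamma> s)) (at s within {0..1})"
      using g that t by (auto simp: integral_curve_def)
  qed (use t in auto)
  have "norm (f (t + h) - f t) \<le> M / 2 * h * \<bar>t + h - t\<bar>"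
  proof (rule norm_diff_le_if_vector_derivative_le[of "{t..t+h}" f "\<lambda>s. v (\<gamma> s) - v (\<gamma> t)"])
    show "(f has_vector_derivative v (\<gamma> s) - v (\<gamma> t)) (at s within {t..t+h})" if "s \<in> {t..t+h}" for s
      unfolding f_def by (auto intro!: derivative_eq_intros D that)
    show "norm (v (\<gamma> s) - v (\<gamma> t)) \<le> M / 2 * h" if s: "s \<in> {t..t+h}" for s
    proof -
      have "norm (\<gamma> s - \<gamma> t) \<le> M * \<bar>s - t\<bar>"
        by (rule norm_diff_le_if_vector_derivative_le[OF convex_real_interval(5)[of t "t + h"] D M])
           (use s t in auto)
      also have "\<dots> \<le> M * h" using s t order_trans[OF norm_ge_zero M[of 0]] by (intro mult_left_mono) auto
      finally show ?thesis using lip[of "\<gamma> s" "\<gamma> t"] by linarith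
    qed
  qed (use t in auto)
  then show ?thesis using t by (simp add: f_def algebra_simps power2_eq_square)
qed

text \<open>
  The local error of the scheme against the curve is $A h^2$ with $A = C + M/2$. Since one
  step of size $h$ multiplies distances by at most $1 + h/2$, the error after $k$ steps is at most
  $2 A h ((1 + h/2)^k - 1)$, and $(1 + h/2)^k \le e^{1/2} \le 2$.
\<close>

lemma one_step_scheme_converges:
  fixes v :: "'a::real_normed_vector \<Rightarrow> 'a"
  assumes lip: "\<And>x y. norm (v x - v y) \<le> 1 / 2 * norm (x - y)" and M: "\<And>x. norm (v x) \<le> M"
    and g: "integral_curve v \<gamma>" and h: "h = 1 / real (Suc n)"
    and step: "\<And>x. norm (\<Psi> x - x - h *\<^sub>R v x) \<le> C * h\<^sup>2" and k: "k \<le> Suc n"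
  shows "norm ((\<Psi> ^^ k) (\<gamma> 0) - \<gamma> (k * h)) \<le> (2 * C + M) * h"
proof -
  define A where "A = C + M / 2"
  have h0: "h > 0" by (simp add: h)
  have "0 \<le> C * h\<^sup>2" using step[of 0] norm_ge_zero order_trans by blast
  then have "C \<ge> 0" using h0 by (simp add: zero_le_mult_iff)
  moreover have "M \<ge> 0" using M[of 0] norm_ge_zero order_trans by blast
  ultimately have A0: "A \<ge> 0" by (simp add: A_def)
  have "norm ((\<Psi> ^^ k) (\<gamma> 0) - \<gamma> (k * h)) \<le> 2 * A * h * ((1 + h / 2) ^ k - 1)" using k
  proof (induction k)
    case (Suc k)
    define z where "z = (\<Psi> ^^ k) (\<gamma> 0)"
    define y where "y = \<gamma> (k * h)"
    have "real (Suc k) * h \<le> 1" using Suc.prems by (simp add: h field_simps)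
    then have 1: "norm (\<gamma> (k * h + h) - y - h *\<^sub>R v y) \<le> M / 2 * h\<^sup>2"
      unfolding y_def by (intro integral_curve_euler_step[OF lip M g]) (use h0 in \<open>auto simp: algebra_simps\<close>)
    have 2: "norm (\<Psi> z - z - h *\<^sub>R v z) \<le> C * h\<^sup>2" by (rule step)
    have 3: "norm (h *\<^sub>R (v z - v y)) \<le> h * (1 / 2 * norm (z - y))"
      using lip[of z y] h0 by simp
    have "\<Psi> z - \<gamma> (k * h + h) = (\<Psi> z - z - h *\<^sub>R v z) + (z - y) + h *\<^sub>R (v z - v y)
        - (\<gamma> (k * h + h) - y - h *\<^sub>R v y)" by (simp add: algebra_simps)
    also have "norm \<dots> \<le> C * h\<^sup>2 + norm (z - y) + h * (1 / 2 * norm (z - y)) + M / 2 * h\<^sup>2"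
      by (rule order_trans[OF norm_triangle_ineq4 add_mono[OF _ 1]],
          rule order_trans[OF norm_triangle_ineq add_mono[OF _ 3]],
          rule order_trans[OF norm_triangle_ineq add_mono[OF 2]]) simp
    also have "\<dots> = (1 + h / 2) * norm (z - y) + A * h\<^sup>2" by (simp add: A_def algebra_simps)
    also have "\<dots> \<le> (1 + h / 2) * (2 * A * h * ((1 + h / 2) ^ k - 1)) + A * h\<^sup>2"
      using Suc h0 A0 by (intro add_mono mult_left_mono) (auto simp: z_def y_def)
    also have "\<dots> = 2 * A * h * ((1 + h / 2) ^ Suc k - 1)"
      by (simp add: algebra_simps power2_eq_square)
    finally show ?case by (simp add: z_def algebra_simps)
  qed simp
  also have "\<dots> \<le> 2 * A * h * 1"
  proof (intro mult_left_mono)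
    have "(1 + h / 2) ^ k \<le> exp (h / 2) ^ k" using h0 exp_ge_add_one_self[of "h/2"] by (intro power_mono) auto
    also have "\<dots> = exp (real k * (h / 2))" by (rule exp_of_nat_mult[symmetric])
    also have "\<dots> \<le> exp (1 / 2)" using k by (simp add: h field_simps)
    also have "\<dots> \<le> 2" using exp_bound_half[of "1/2 :: real"] by simp
    finally show "(1 + h / 2) ^ k - 1 \<le> 1" by simp
  qed (use A0 h0 in auto)
  finally show ?thesis by (simp add: A_def algebra_simps)
qed

section \<open>Approximation of a flow by compositions of shears\<close>

text \<open>
  For a list of all coordinates, each occurring once, this composition of shears is a first order
  scheme for $\dot x = v(x)$ whose Jacobian is an explicit product.
\<close>

primrec shears :: "(real^'d \<Rightarrow> real^'d) \<Rightarrow> real \<Rightarrow> 'd list \<Rightarrow> real^'d \<Rightarrow> real^'d"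
  where
    "shears v h [] x = x"
  | "shears v h (j # js) x = shears v h js (x + (h * v x $ j) *\<^sub>R axis j 1)"

primrec shears_jacobian :: "(real^'d \<Rightarrow> real^'d) \<Rightarrow> real \<Rightarrow> 'd list \<Rightarrow> real^'d \<Rightarrow> real"
  where
    "shears_jacobian v h [] x = 1"
  | "shears_jacobian v h (j # js) x =
       (1 + h * partial j v x $ j) * shears_jacobian v h js (x + (h * v x $ j) *\<^sub>R axis j 1)"

text \<open>
  The constant $1/2$ matches the assumption on integral curves and keeps the Jacobians of all
  shears with $0 \le h \le 1$ positive.
\<close>

locale compact_C1_field =
  fixes v :: "real^'d \<Rightarrow> real^'d" and K :: "(real^'d) set"
  assumes diff: "v differentiable_on UNIV"
    and cont_partial: "\<And>j. continuous_on UNIV (partial j v)"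
    and lip: "\<And>x y. norm (v x - v y) \<le> 1 / 2 * norm (x - y)"
    and K: "compact K" and outside: "\<And>x. x \<notin> K \<Longrightarrow> v x = 0"
begin

lemma cont: "continuous_on UNIV v"
  using diff by (rule differentiable_imp_continuous_on)

lemma partial_component: "partial j (\<lambda>x. v x $ j) x = partial j v x $ j"
proof -
  have "(v has_derivative frechet_derivative v (at x)) (at x)"
    using diff by (auto simp: differentiable_on_def frechet_derivative_works)
  then have "((\<lambda>x. v x $ j) has_derivative (\<lambda>h. frechet_derivative v (at x) h $ j)) (at x)"
    by (rule bounded_linear.has_derivative[OF bounded_linear_vec_nth])
  from partial_eqI[OF this, of j] show ?thesis by (simp only: partial_def)
qed

lemma dir_deriv_component: "dir_deriv (axis j 1) (\<lambda>x. v x $ j) (\<lambda>x. partial j v x $ j)"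
proof -
  have "(\<lambda>x. v x $ j) differentiable_on UNIV"
    using diff bounded_linear.has_derivative[OF bounded_linear_vec_nth]
    unfolding differentiable_on_def differentiable_def by blast
  moreover have "partial j (\<lambda>x. v x $ j) = (\<lambda>x. partial j v x $ j)" by (rule ext) (rule partial_component)
  ultimately show ?thesis using dir_deriv_partial[of "\<lambda>x. v x $ j" j] by (simp only:)
qed

lemma partial_component_bound: "\<bar>partial j v x $ j\<bar> \<le> 1 / 2"
proof -
  have "((\<lambda>s. (v (x + (0 + s) *\<^sub>R axis j 1) $ j - v (x + 0 *\<^sub>R axis j 1) $ j) / s) \<longlongrightarrow> partial j v x $ j) (at 0)"
    using dir_deriv_component[of j] by (auto simp: dir_deriv_def DERIV_def)
  then have "((\<lambda>s. \<bar>(v (x + s *\<^sub>R axis j 1) $ j - v x $ j) / s\<bar>) \<longlongrightarrow> \<bar>partial j v x $ j\<bar>) (at 0)"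
    by (intro tendsto_rabs) simp
  moreover have "\<bar>(v (x + s *\<^sub>R axis j 1) $ j - v x $ j) / s\<bar> \<le> 1 / 2" if "s \<noteq> 0" for s
  proof -
    have "\<bar>v (x + s *\<^sub>R axis j 1) $ j - v x $ j\<bar> \<le> norm (v (x + s *\<^sub>R axis j 1) - v x)"
      using component_le_norm_cart[of "v (x + s *\<^sub>R axis j 1) - v x" j] by simp
    also have "\<dots> \<le> 1 / 2 * norm (s *\<^sub>R axis j (1::real) :: real^'d)"
      using lip[of "x + s *\<^sub>R axis j 1" x] by simp
    finally show ?thesis using that by (simp add: field_simps norm_axis_1)
  qed
  ultimately show ?thesis
    by (intro tendsto_upperbound) (auto simp: eventually_at_filter)
qed

lemma partial_outside: "x \<notin> K \<Longrightarrow> partial j v x $ j = 0"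
  using dir_deriv_outside_support[OF dir_deriv_component compact_imp_closed[OF K]] outside by auto

lemma field_bounded: obtains M where "M \<ge> 0" "\<And>x. norm (v x) \<le> M"
proof -
  have "bounded (v ` K)"
    using compact_continuous_image[OF continuous_on_subset[OF cont] K] compact_imp_bounded by blast
  then obtain M where "M > 0" "\<And>x. x \<in> K \<Longrightarrow> norm (v x) \<le> M" by (auto simp: bounded_pos)
  then show ?thesis using outside that[of M] by (metis less_imp_le norm_zero)
qed

lemma continuous_shear: "continuous_on UNIV (\<lambda>x. x + (h * v x $ j) *\<^sub>R axis j 1)"
  by (intro continuous_intros cont)

lemma continuous_shears: "continuous_on UNIV (shears v h js)"
proof (induction js)
  case (Cons j js)
  then show ?case using continuous_on_compose2[OF Cons continuous_shear[of h j]] by simp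
qed simp

lemma continuous_shears_jacobian: "continuous_on UNIV (shears_jacobian v h js)"
proof (induction js)
  case (Cons j js)
  then show ?case
    using continuous_on_compose2[OF Cons continuous_shear[of h j]]
    by (auto intro!: continuous_intros cont_partial)
qed simp

lemma shears_outside: "x \<notin> K \<Longrightarrow> shears v h js x = x" "x \<notin> K \<Longrightarrow> shears_jacobian v h js x = 1"
  by (induction js) (simp_all add: outside partial_outside)

lemma shears_integral:
  assumes "0 \<le> h" "h \<le> 1" "f \<in> borel_measurable borel"
  shows "(\<integral>x. f (shears v h js x) * shears_jacobian v h js x \<partial>lborel) = integral\<^sup>L lborel f"
  using assms(3)
proof (induction js arbitrary: f)
  case (Cons j js)
  note [measurable] = Cons.prems borel_measurable_continuous_onI[OF continuous_shears]
    borel_measurable_continuous_onI[OF continuous_shears_jacobian]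
  define F where "F y = f (shears v h js y) * shears_jacobian v h js y" for y
  have "(\<integral>x. f (shears v h (j # js) x) * shears_jacobian v h (j # js) x \<partial>lborel)
      = (\<integral>x. F (x + (h * v x $ j) *\<^sub>R axis j 1) * (1 + h * partial j v x $ j) \<partial>lborel)"
    by (simp add: F_def mult_ac)
  also have "\<dots> = integral\<^sup>L lborel F"
  proof (rule shear_integral[OF dir_deriv_component _ _ K])
    show "\<bar>h * partial j v x $ j\<bar> \<le> 1" for x
      using mult_mono[of h 1 "\<bar>partial j v x $ j\<bar>" "1/2"] partial_component_bound[of j x] assms(1,2)
      by (simp add: abs_mult)
    show "F \<in> borel_measurable borel" unfolding F_def[abs_def] by measurable
  qed (auto intro!: continuous_intros cont cont_partial simp: outside)
  also have "\<dots> = integral\<^sup>L lborel f" using Cons.IH[OF Cons.prems] by (simp add: F_def[abs_def])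
  finally show ?case .
qed simp

text \<open>
  Each shear evaluates the field at a point that the preceding ones have moved by $O(h)$, which changes
  the increment by $O(h^2)$.
\<close>

lemma shears_consistent_list:
  "\<exists>C\<ge>0. \<forall>x h. 0 \<le> h \<longrightarrow>
    norm (shears v h js x - x - h *\<^sub>R (\<Sum>j\<leftarrow>js. (v x $ j) *\<^sub>R axis j 1)) \<le> C * h\<^sup>2"
proof (induction js)
  case Nil
  then show ?case by (auto intro: exI[of _ 0])
next
  case (Cons j js)
  then obtain C where C: "C \<ge> 0" and IH: "\<And>x h. 0 \<le> h \<Longrightarrow>
    norm (shears v h js x - x - h *\<^sub>R (\<Sum>j\<leftarrow>js. (v x $ j) *\<^sub>R axis j 1)) \<le> C * h\<^sup>2" by blast
  obtain M where M: "M \<ge> 0" "\<And>x. norm (v x) \<le> M" using field_bounded by blast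
  define A where "A y = (\<Sum>j\<leftarrow>js. (v y $ j) *\<^sub>R axis j (1::real))" for y
  have A: "norm (A y - A x) \<le> real (length js) * norm (v y - v x)" for x y
    unfolding A_def
  proof (induction js)
    case (Cons i js)
    have i: "norm ((v y $ i) *\<^sub>R axis i (1::real) - (v x $ i) *\<^sub>R axis i 1) \<le> norm (v y - v x)"
      using component_le_norm_cart[of "v y - v x" i]
      by (simp add: scaleR_diff_left[symmetric] norm_axis_1)
    show ?case using norm_triangle_mono[OF i Cons]
      by (simp only: list.map sum_list.Cons add_diff_add length_Cons of_nat_Suc distrib_right mult_1)
  qed simp
  show ?case
  proof (intro exI[of _ "C + real (length js) * (M / 2)"] conjI allI impI)
    show "0 \<le> C + real (length js) * (M / 2)" using C M(1) by simp
    fix x and h :: real assume h: "0 \<le> h"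
    define y where "y = x + (h * v x $ j) *\<^sub>R axis j 1"
    have "norm (y - x) \<le> h * M"
      using component_le_norm_cart[of "v x" j] M(2)[of x] h
      by (simp add: y_def norm_axis_1 abs_mult mult_left_mono)
    then have "norm (v y - v x) \<le> h * M / 2" using lip[of y x] by linarith
    then have "norm (A y - A x) \<le> real (length js) * (h * M / 2)"
      using A[of y x] by (meson mult_left_mono of_nat_0_le_iff order_trans)
    from mult_left_mono[OF this h]
    have 2: "norm (h *\<^sub>R (A y - A x)) \<le> h * (real (length js) * (h * M / 2))"
      using h by simp
    have 1: "norm (shears v h js y - y - h *\<^sub>R A y) \<le> C * h\<^sup>2" using IH[OF h] by (simp add: A_def)
    have "(\<Sum>j\<leftarrow>j # js. (v x $ j) *\<^sub>R axis j (1::real)) = (v x $ j) *\<^sub>R axis j 1 + A x"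
      "shears v h (j # js) x = shears v h js y" by (simp_all add: y_def A_def)
    then have eq: "shears v h (j # js) x - x - h *\<^sub>R (\<Sum>j\<leftarrow>j # js. (v x $ j) *\<^sub>R axis j 1)
       = (shears v h js y - y - h *\<^sub>R A y) + h *\<^sub>R (A y - A x)"
      by (simp only:) (simp add: y_def algebra_simps)
    have "C * h\<^sup>2 + h * (real (length js) * (h * M / 2)) = (C + real (length js) * (M / 2)) * h\<^sup>2"
      by (simp add: algebra_simps power2_eq_square)
    then show "norm (shears v h (j # js) x - x - h *\<^sub>R (\<Sum>j\<leftarrow>j # js. (v x $ j) *\<^sub>R axis j 1))
       \<le> (C + real (length js) * (M / 2)) * h\<^sup>2"
      using norm_triangle_mono[OF 1 2] unfolding eq by linarith
  qed
qed

lemma shears_consistent: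
  assumes "distinct js" "set js = UNIV"
  obtains C where "C \<ge> 0" "\<And>x h. 0 \<le> h \<Longrightarrow> norm (shears v h js x - x - h *\<^sub>R v x) \<le> C * h\<^sup>2"
proof -
  have "(\<Sum>j\<leftarrow>js. (v x $ j) *\<^sub>R axis j 1) = v x" for x
    using basis_expansion[of "v x"] assms by (simp add: sum_list_distinct_conv_sum_set scalar_mult_eq_scaleR)
  then show ?thesis using shears_consistent_list[of js] that by auto
qed

lemma shears_jacobian_bound:
  "\<exists>C\<ge>0. \<forall>x h. 0 \<le> h \<longrightarrow> h \<le> 1 \<longrightarrow> \<bar>shears_jacobian v h js x - 1\<bar> \<le> C * h"
proof (induction js)
  case Nil
  then show ?case by (auto intro: exI[of _ 0])
next
  case (Cons j js)
  then obtain C where C: "C \<ge> 0" and IH: "\<And>x h. 0 \<le> h \<Longrightarrow> h \<le> 1 \<Longrightarrow> \<bar>shears_jacobian v h js x - 1\<bar> \<le> C * h"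
    by blast
  show ?case
  proof (intro exI[of _ "C * (3 / 2) + 1 / 2"] conjI allI impI)
    show "0 \<le> C * (3 / 2) + 1 / 2" using C by simp
    fix x and h :: real assume h: "0 \<le> h" "h \<le> 1"
    define a where "a = partial j v x $ j"
    define J where "J = shears_jacobian v h js (x + (h * v x $ j) *\<^sub>R axis j 1)"
    have a: "\<bar>a\<bar> \<le> 1 / 2" using partial_component_bound by (simp add: a_def)
    have ha: "\<bar>h * a\<bar> \<le> h * (1 / 2)" using mult_left_mono[OF a h(1)] h by (simp add: abs_mult)
    have "\<bar>1 + h * a\<bar> \<le> 3 / 2" using ha h by linarith
    moreover have "\<bar>J - 1\<bar> \<le> C * h" using IH[OF h] by (simp add: J_def)
    ultimately have "\<bar>J - 1\<bar> * \<bar>1 + h * a\<bar> \<le> (C * h) * (3 / 2)" by (intro mult_mono) (use C h in auto)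
    moreover have "(1 + h * a) * J - 1 = (J - 1) * (1 + h * a) + h * a" by (simp add: algebra_simps)
    ultimately have "\<bar>(1 + h * a) * J - 1\<bar> \<le> (C * h) * (3 / 2) + h * (1 / 2)"
      using ha abs_triangle_ineq[of "(J - 1) * (1 + h * a)" "h * a"] by (simp add: abs_mult)
    then show "\<bar>shears_jacobian v h (j # js) x - 1\<bar> \<le> (C * (3 / 2) + 1 / 2) * h"
      by (simp add: a_def J_def algebra_simps)
  qed
qed

text \<open>
  The base point may vary with $n$, because in the induction the remaining shears start from a point
  that the first one has moved.
\<close>

lemma shears_jacobian_expansion_list:
  assumes "y \<longlonglongrightarrow> x"
  shows "(\<lambda>n. real (Suc n) * (shears_jacobian v (1 / real (Suc n)) js (y n) - 1))
    \<longlonglongrightarrow> (\<Sum>j\<leftarrow>js. partial j v x $ j)"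
  using assms
proof (induction js arbitrary: y)
  case (Cons j js)
  define y' where "y' n = y n + (1 / real (Suc n) * v (y n) $ j) *\<^sub>R axis j 1" for n
  define J where "J n = shears_jacobian v (1 / real (Suc n)) js (y' n)" for n
  have inv: "(\<lambda>n. 1 / real (Suc n)) \<longlonglongrightarrow> 0" using LIMSEQ_inverse_real_of_nat by (simp add: inverse_eq_divide)
  have v: "(\<lambda>n. v (y n)) \<longlonglongrightarrow> v x" and D: "(\<lambda>n. partial j v (y n)) \<longlonglongrightarrow> partial j v x"
    using continuous_on_tendsto_compose[OF cont Cons.prems]
      continuous_on_tendsto_compose[OF cont_partial Cons.prems] by auto
  have "y' \<longlonglongrightarrow> x + (0 * v x $ j) *\<^sub>R axis j 1"
    unfolding y'_def by (intro tendsto_intros Cons.prems inv v)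
  then have IH: "(\<lambda>n. real (Suc n) * (J n - 1)) \<longlonglongrightarrow> (\<Sum>j\<leftarrow>js. partial j v x $ j)"
    unfolding J_def by (intro Cons.IH) simp
  have "(\<lambda>n. 1 / real (Suc n) * (real (Suc n) * (J n - 1)) + 1) \<longlonglongrightarrow> 0 * (\<Sum>j\<leftarrow>js. partial j v x $ j) + 1"
    by (intro tendsto_intros IH inv)
  then have J: "J \<longlonglongrightarrow> 1" by simp
  have "(\<lambda>n. real (Suc n) * (J n - 1) + partial j v (y n) $ j * J n)
      \<longlonglongrightarrow> (\<Sum>j\<leftarrow>js. partial j v x $ j) + partial j v x $ j * 1"
    by (intro tendsto_intros IH J D)
  moreover have "real (Suc n) * (J n - 1) + partial j v (y n) $ j * J n
      = real (Suc n) * (shears_jacobian v (1 / real (Suc n)) (j # js) (y n) - 1)" for n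
  proof -
    have "shears_jacobian v (1 / real (Suc n)) (j # js) (y n) = (1 + 1 / real (Suc n) * partial j v (y n) $ j) * J n"
      by (simp add: J_def y'_def del: of_nat_Suc)
    moreover have "r * ((1 + 1 / r * a) * b - 1) = r * (b - 1) + a * b" if "r \<noteq> 0" for r a b :: real
      using that by (simp add: field_simps)
    ultimately show ?thesis using of_nat_0_less_iff[of "Suc n"] by (metis of_nat_eq_0_iff old.nat.distinct(2))
  qed
  ultimately show ?case by (simp add: add.commute)
qed simp

end

section \<open>Divergence of a vector field over an invariant set\<close>

context compact_C1_field
begin

text \<open>
  The functions $f_n(z) = \min(1, \sqrt{n + 1}\; d(z, U^c))$ approximate the indicator function of
  $U$. Their Lipschitz constant grows more slowly than the error $B/(n + 1)$ of the scheme shrinks,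
  so that $f_n$ takes nearly the same values at the iterates as on the integral curve through $x$. That
  curve either stays outside $U$ or, by compactness, keeps a positive distance from $U^c$.
\<close>

lemma infdist_approx_indicator:
  fixes U :: "(real^'d) set"
  assumes U: "open U" "bounded U"
    and inv: "\<And>\<gamma> t. integral_curve v \<gamma> \<Longrightarrow> t \<in> {0..1} \<Longrightarrow> \<gamma> 0 \<in> U \<longleftrightarrow> \<gamma> t \<in> U"
    and \<Psi>: "\<And>n z. norm (\<Psi> n z - z - (1 / real (Suc n)) *\<^sub>R v z) \<le> C * (1 / real (Suc n))\<^sup>2"
    and "\<epsilon> > 0"
  shows "\<forall>\<^sub>F n in sequentially. \<forall>k\<le>Suc n.
    \<bar>min 1 (sqrt (real (Suc n)) * infdist ((\<Psi> n ^^ k) x) (- U)) - indicator U x\<bar> \<le> \<epsilon>"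
proof -
  have ne: "- U \<noteq> {}" using U(2) not_bounded_UNIV[where 'a = "real^'d"] by (metis double_compl Compl_empty_eq)
  obtain \<gamma> where g: "integral_curve v \<gamma>" "\<gamma> 0 = x" using integral_curve_exists[of v x] lip by blast
  obtain M where M: "\<And>x. norm (v x) \<le> M" using field_bounded by blast
  define B where "B = 2 * C + M"
  have close: "dist ((\<Psi> n ^^ k) x) (\<gamma> (k / real (Suc n))) \<le> B / real (Suc n)" if "k \<le> Suc n" for n k
    using one_step_scheme_converges[OF lip M g(1) refl \<Psi> that] g(2) by (simp add: B_def dist_norm)
  have inv0: "(\<lambda>n. 1 / real (Suc n)) \<longlonglongrightarrow> 0" using LIMSEQ_inverse_real_of_nat by (simp add: inverse_eq_divide)
  have sqrt_top: "filterlim (\<lambda>n. sqrt (real (Suc n))) at_top sequentially"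
    by (rule filterlim_compose[OF sqrt_at_top filterlim_compose[OF filterlim_real_sequentially filterlim_Suc]])
  show ?thesis
  proof (cases "x \<in> U")
    case True
    have "continuous_on {0..1} (\<lambda>t. infdist (\<gamma> t) (- U))"
      by (intro continuous_on_infdist integral_curve_continuous[OF g(1)])
    then obtain s where s: "s \<in> {0..1}" "\<And>t. t \<in> {0..1} \<Longrightarrow> infdist (\<gamma> s) (- U) \<le> infdist (\<gamma> t) (- U)"
      using continuous_attains_inf[of "{0..1::real}" "\<lambda>t. infdist (\<gamma> t) (- U)"] by auto
    define \<delta> where "\<delta> = infdist (\<gamma> s) (- U)"
    have "\<gamma> s \<notin> - U" using inv[OF g(1) s(1)] True g(2) by simp
    then have \<delta>: "\<delta> > 0"
      unfolding \<delta>_def using infdist_pos_not_in_closed[of "- U"] U(1) ne by (simp add: closed_Compl)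
    have "(\<lambda>n. \<delta> - B * (1 / real (Suc n))) \<longlonglongrightarrow> \<delta> - B * 0"
      by (intro tendsto_intros inv0)
    then have "(\<lambda>n. \<delta> - B / real (Suc n)) \<longlonglongrightarrow> \<delta>" by simp
    from filterlim_tendsto_pos_mult_at_top[OF this \<delta> sqrt_top]
    have "\<forall>\<^sub>F n in sequentially. 1 \<le> (\<delta> - B / real (Suc n)) * sqrt (real (Suc n))"
      unfolding filterlim_at_top by blast
    then show ?thesis
    proof eventually_elim
      case (elim n)
      show ?case
      proof (intro allI impI)
        fix k assume k: "k \<le> Suc n"
        define z where "z = (\<Psi> n ^^ k) x"
        have "real k / real (Suc n) \<in> {0..1}" using k by (simp add: field_simps)
        then have "\<delta> \<le> infdist (\<gamma> (k / real (Suc n))) (- U)" unfolding \<delta>_def by (rule s(2))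
        also have "\<dots> \<le> infdist z (- U) + dist z (\<gamma> (k / real (Suc n)))"
          using infdist_triangle[of "\<gamma> (k / real (Suc n))" "- U" z] by (simp add: dist_commute)
        finally have "\<delta> - B / real (Suc n) \<le> infdist z (- U)" using close[OF k] by (simp add: z_def)
        then have "(\<delta> - B / real (Suc n)) * sqrt (real (Suc n)) \<le> infdist z (- U) * sqrt (real (Suc n))"
          by (intro mult_right_mono) auto
        from order_trans[OF elim this] have "1 \<le> sqrt (real (Suc n)) * infdist z (- U)"
          by (simp only: mult.commute)
        then show "\<bar>min 1 (sqrt (real (Suc n)) * infdist ((\<Psi> n ^^ k) x) (- U)) - indicator U x\<bar> \<le> \<epsilon>"
          using True \<open>\<epsilon> > 0\<close> by (simp add: z_def min_absorb1)
      qed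
    qed
  next
    case False
    have "(\<lambda>n. B * inverse (sqrt (real (Suc n)))) \<longlonglongrightarrow> B * 0"
      by (intro tendsto_intros filterlim_compose[OF tendsto_inverse_0_at_top sqrt_top] tendsto_inverse_0_at_top sqrt_top)
    then have "\<forall>\<^sub>F n in sequentially. B * inverse (sqrt (real (Suc n))) < \<epsilon>"
      using \<open>\<epsilon> > 0\<close> by (auto dest: order_tendstoD(2))
    then show ?thesis
    proof eventually_elim
      case (elim n)
      show ?case
      proof (intro allI impI)
        fix k assume k: "k \<le> Suc n"
        define z where "z = (\<Psi> n ^^ k) x"
        have "real k / real (Suc n) \<in> {0..1}" using k by (simp add: field_simps)
        then have "\<gamma> (k / real (Suc n)) \<in> - U" using inv[OF g(1)] False g(2) by blast
        then have "infdist z (- U) \<le> B / real (Suc n)"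
          using infdist_triangle[of z "- U" "\<gamma> (k / real (Suc n))"] close[OF k] by (simp add: z_def)
        then have "sqrt (real (Suc n)) * infdist z (- U) \<le> sqrt (real (Suc n)) * (B / real (Suc n))"
          by (intro mult_left_mono) auto
        also have "\<dots> = B * inverse (sqrt (real (Suc n)))"
        proof -
          have "sqrt (real (Suc n)) * (B / (sqrt (real (Suc n)) * sqrt (real (Suc n)))) = B * inverse (sqrt (real (Suc n)))"
            by (simp add: divide_inverse del: real_sqrt_mult_self of_nat_Suc)
          then show ?thesis by simp
        qed
        finally have "sqrt (real (Suc n)) * infdist z (- U) \<le> \<epsilon>" using elim by linarith
        moreover have "0 \<le> sqrt (real (Suc n)) * infdist z (- U)" by (simp add: infdist_nonneg)
        ultimately show "\<bar>min 1 (sqrt (real (Suc n)) * infdist ((\<Psi> n ^^ k) x) (- U)) - indicator U x\<bar> \<le> \<epsilon>"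
          using False by (simp add: z_def[symmetric])
      qed
    qed
  qed
qed

text \<open>
  Let $I_k = \int f_n(\Psi^k x)\, dx$ with $f_n \to 1_U$ as above and $h = 1/(n + 1)$. The change of
  variables under one step gives
  $I_k - I_{k+1} = \int f_n(\Psi^{k+1} x) (J(x) - 1)\, dx$, where $J$ is the Jacobian of $\Psi$. Summed over
  $k \le n$, the right-hand sides tend to $\int_U \mathrm{div}\, v$ by dominated convergence, because
  $(J - 1)/h \to \mathrm{div}\, v$, whereas $I_0$ and $I_{n+1}$ both tend to the volume of $U$.
\<close>

theorem integral_divergence_over_invariant_set:
  fixes U :: "(real^'d) set"
  assumes U: "open U" "bounded U"
    and inv: "\<And>\<gamma> t. integral_curve v \<gamma> \<Longrightarrow> t \<in> {0..1} \<Longrightarrow> \<gamma> 0 \<in> U \<longleftrightarrow> \<gamma> t \<in> U"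
  shows "(\<integral>x. indicator U x * (\<Sum>j\<in>UNIV. partial j v x $ j) \<partial>lborel) = 0"
proof -
  obtain js :: "'d list" where js: "set js = UNIV" "distinct js"
    using finite_distinct_list[OF finite_class.finite_UNIV] by blast
  obtain C where C: "C \<ge> 0" "\<And>x h. 0 \<le> h \<Longrightarrow> norm (shears v h js x - x - h *\<^sub>R v x) \<le> C * h\<^sup>2"
    using shears_consistent[OF js(2,1)] by blast
  obtain D where D: "D \<ge> 0" "\<And>x h. 0 \<le> h \<Longrightarrow> h \<le> 1 \<Longrightarrow> \<bar>shears_jacobian v h js x - 1\<bar> \<le> D * h"
    using shears_jacobian_bound[of js] by blast
  define \<Psi> where "\<Psi> n = shears v (1 / real (Suc n)) js" for n
  define J where "J n = shears_jacobian v (1 / real (Suc n)) js" for n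
  define f where "f n x = min 1 (sqrt (real (Suc n)) * infdist x (- U))" for n and x :: "real^'d"
  \<comment> \<open>The mean of the approximate indicator along the discrete orbit of \<open>x\<close>.\<close>
  define p where "p n x = (\<Sum>k<Suc n. f n ((\<Psi> n ^^ Suc k) x)) / real (Suc n)" for n x
  have h: "0 \<le> 1 / real (Suc n)" "1 / real (Suc n) \<le> 1" for n by auto
  have [measurable]: "\<Psi> n \<in> borel_measurable borel" "J n \<in> borel_measurable borel" "f n \<in> borel_measurable borel" for n
    unfolding \<Psi>_def J_def f_def
    by (auto intro!: borel_measurable_continuous_onI continuous_shears continuous_shears_jacobian
        continuous_intros continuous_on_infdist)
  have [measurable]: "(\<Psi> n ^^ k) \<in> borel_measurable borel" for n k
    by (induction k) (simp_all add: measurable_comp[of _ borel borel, unfolded comp_def] o_def)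
  have f_bounds: "0 \<le> f n x" "f n x \<le> 1" for n x by (auto simp: f_def infdist_nonneg)
  have f_out: "f n x = 0" if "x \<notin> U" for n x using that by (simp add: f_def)
  have \<Psi>_out: "(\<Psi> n ^^ k) x = x" if "x \<notin> K" for n k x
    by (induction k) (use that shears_outside(1) in \<open>simp_all add: \<Psi>_def\<close>)
  have near: "\<forall>\<^sub>F n in sequentially. \<forall>k\<le>Suc n. \<bar>f n ((\<Psi> n ^^ k) x) - indicator U x\<bar> \<le> \<epsilon>" if "\<epsilon> > 0" for \<epsilon> x
    unfolding f_def
    by (rule infdist_approx_indicator[OF U inv _ that, where C = C])
       (simp_all only: \<Psi>_def C(2)[OF h(1)])
  \<comment> \<open>The scheme fixes every point outside \<open>K\<close>, so all integrands vanish outside this set.\<close>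
  define E where "E = U \<union> K"
  have E: "bounded E" "E \<in> sets borel" using U K by (auto simp: E_def compact_imp_bounded borel_compact)
  note [measurable] = E(2)
  have Eint: "integrable lborel (\<lambda>x. indicator E x * c :: real)" for c
    using E emeasure_bounded_finite[OF E(1)] by (intro integrable_mult_left integrable_real_indicator) auto
  have f_le: "norm (f n ((\<Psi> n ^^ k) x)) \<le> indicator E x * 1" for n k x
  proof (cases "x \<in> E")
    case False
    then have "x \<notin> K" "x \<notin> U" by (auto simp: E_def)
    then show ?thesis using \<Psi>_out f_out by simp
  qed (use f_bounds in auto)
  have J_le: "\<bar>real (Suc n) * (J n x - 1)\<bar> \<le> D" for n x
  proof -
    have "\<bar>J n x - 1\<bar> \<le> D / real (Suc n)" using D(2)[OF h, of n x] by (simp add: J_def del: of_nat_Suc)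
    then show ?thesis by (simp add: abs_mult pos_le_divide_eq mult.commute del: of_nat_Suc)
  qed
  have J_out: "J n x = 1" if "x \<notin> K" for n x using that shears_outside(2) by (simp add: J_def)
  have fint: "integrable lborel (\<lambda>x. f n ((\<Psi> n ^^ k) x))" for n k
    by (rule Bochner_Integration.integrable_bound[OF Eint[of 1]]) (use f_le in auto)
  have gint: "integrable lborel (\<lambda>x. f n ((\<Psi> n ^^ k) x) * (J n x - 1))" for n k
  proof (rule Bochner_Integration.integrable_bound[OF Eint[of D]])
    have "norm (f n ((\<Psi> n ^^ k) x) * (J n x - 1)) \<le> norm (indicator E x * D)" for x
    proof -
      have "\<bar>J n x - 1\<bar> \<le> D * (1 / real (Suc n))" using D(2)[OF h] by (simp add: J_def)
      also have "\<dots> \<le> D * 1" using D(1) h by (intro mult_left_mono)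
      finally show ?thesis using f_le[of n k x] D(1) mult_mono[of "norm (f n ((\<Psi> n ^^ k) x))" "indicator E x" "\<bar>J n x - 1\<bar>" D]
        by (simp add: abs_mult)
    qed
    then show "AE x in lborel. norm (f n ((\<Psi> n ^^ k) x) * (J n x - 1)) \<le> norm (indicator E x * D)" by simp
  qed measurable
  have step: "(\<integral>x. f n ((\<Psi> n ^^ k) x) \<partial>lborel) - (\<integral>x. f n ((\<Psi> n ^^ Suc k) x) \<partial>lborel)
     = (\<integral>x. f n ((\<Psi> n ^^ Suc k) x) * (J n x - 1) \<partial>lborel)" for n k
  proof -
    have "(\<integral>x. f n ((\<Psi> n ^^ k) (\<Psi> n x)) * J n x \<partial>lborel) = (\<integral>x. f n ((\<Psi> n ^^ k) x) \<partial>lborel)"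
      unfolding \<Psi>_def J_def by (rule shears_integral[OF h]) (fold \<Psi>_def, measurable)
    then have "(\<integral>x. f n ((\<Psi> n ^^ Suc k) x) * (J n x - 1) + f n ((\<Psi> n ^^ Suc k) x) \<partial>lborel) = (\<integral>x. f n ((\<Psi> n ^^ k) x) \<partial>lborel)"
      by (simp add: algebra_simps funpow_swap1)
    then show ?thesis using Bochner_Integration.integral_add[OF gint[of n "Suc k"] fint[of n "Suc k"]] by simp
  qed
  have eq: "(\<integral>x. p n x * (real (Suc n) * (J n x - 1)) \<partial>lborel)
      = (\<integral>x. f n x \<partial>lborel) - (\<integral>x. f n ((\<Psi> n ^^ Suc n) x) \<partial>lborel)" for n
  proof -
    have "(\<integral>x. f n x \<partial>lborel) - (\<integral>x. f n ((\<Psi> n ^^ Suc n) x) \<partial>lborel)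
      = (\<Sum>k<Suc n. (\<integral>x. f n ((\<Psi> n ^^ k) x) \<partial>lborel) - (\<integral>x. f n ((\<Psi> n ^^ Suc k) x) \<partial>lborel))"
      by (subst sum_lessThan_telescope') simp
    also have "\<dots> = (\<integral>x. (\<Sum>k<Suc n. f n ((\<Psi> n ^^ Suc k) x) * (J n x - 1)) \<partial>lborel)"
      unfolding step by (rule Bochner_Integration.integral_sum[symmetric]) (rule gint)
    also have "(\<lambda>x. \<Sum>k<Suc n. f n ((\<Psi> n ^^ Suc k) x) * (J n x - 1)) = (\<lambda>x. p n x * (real (Suc n) * (J n x - 1)))"
      unfolding p_def by (simp add: sum_distrib_right[symmetric] del: of_nat_Suc sum.lessThan_Suc funpow.simps)
    finally show ?thesis by simp
  qed
  have lim_const: "(\<lambda>n. f n ((\<Psi> n ^^ k n) x)) \<longlonglongrightarrow> indicator U x" if "\<And>n. k n \<le> Suc n" for k x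
  proof (rule LIMSEQ_I)
    fix r :: real assume "r > 0"
    then have "\<forall>\<^sub>F n in sequentially. norm (f n ((\<Psi> n ^^ k n) x) - indicator U x) < r"
      using near[of "r/2" x] that by (auto elim!: eventually_mono) (smt (verit) field_sum_of_halves that)
    then show "\<exists>no. \<forall>n\<ge>no. norm (f n ((\<Psi> n ^^ k n) x) - indicator U x) < r"
      by (simp add: eventually_sequentially)
  qed
  have lim_int: "(\<lambda>n. \<integral>x. f n ((\<Psi> n ^^ k n) x) \<partial>lborel) \<longlonglongrightarrow> (\<integral>x. indicator U x \<partial>lborel)" if "\<And>n. k n \<le> Suc n" for k
    by (rule integral_dominated_convergence[OF _ _ Eint[of 1]]) (use U f_le lim_const[OF that] in auto)
  have "(\<lambda>n. \<integral>x. p n x * (real (Suc n) * (J n x - 1)) \<partial>lborel) \<longlonglongrightarrow>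
      (\<integral>x. indicator U x \<partial>lborel) - (\<integral>x. indicator U x \<partial>lborel)"
    unfolding eq using lim_int[of "\<lambda>n. 0"] lim_int[of Suc] by (intro tendsto_diff) auto
  moreover have "(\<lambda>n. \<integral>x. p n x * (real (Suc n) * (J n x - 1)) \<partial>lborel) \<longlonglongrightarrow>
      (\<integral>x. indicator U x * (\<Sum>j\<in>UNIV. partial j v x $ j) \<partial>lborel)"
  proof (rule integral_dominated_convergence[OF _ _ Eint[of D]])
    have [measurable]: "(\<lambda>x. partial j v x $ j) \<in> borel_measurable borel" for j
      by (intro borel_measurable_continuous_onI continuous_on_component cont_partial)
    have [measurable]: "U \<in> sets borel" using U by simp
    show "(\<lambda>x. indicator U x * (\<Sum>j\<in>UNIV. partial j v x $ j)) \<in> borel_measurable lborel" by measurable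
    show "(\<lambda>x. p n x * (real (Suc n) * (J n x - 1))) \<in> borel_measurable lborel" for n
      unfolding p_def by measurable
    have p_bounds: "0 \<le> p n x" "p n x \<le> 1" for n x
    proof -
      show "0 \<le> p n x" unfolding p_def by (intro divide_nonneg_nonneg sum_nonneg f_bounds) auto
      have "(\<Sum>k<Suc n. f n ((\<Psi> n ^^ Suc k) x)) \<le> (\<Sum>k<Suc n. 1)" by (intro sum_mono f_bounds)
      then show "p n x \<le> 1" unfolding p_def by (simp del: funpow.simps)
    qed
    have "norm (p n x * (real (Suc n) * (J n x - 1))) \<le> indicator E x * D" for n x
    proof (cases "x \<in> E")
      case True
      have "\<bar>p n x\<bar> * \<bar>real (Suc n) * (J n x - 1)\<bar> \<le> 1 * D"
        using p_bounds[of n x] J_le[of n x] by (intro mult_mono) auto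
      then show ?thesis using True by (simp add: abs_mult)
    next
      case False
      then show ?thesis using J_out by (simp add: E_def)
    qed
    then show "AE x in lborel. norm (p n x * (real (Suc n) * (J n x - 1))) \<le> indicator E x * D" for n by simp
    have p_lim: "(\<lambda>n. p n x) \<longlonglongrightarrow> indicator U x" for x
    proof (rule LIMSEQ_I)
      fix r :: real assume "r > 0"
      then have "\<forall>\<^sub>F n in sequentially. \<forall>k\<le>Suc n. \<bar>f n ((\<Psi> n ^^ k) x) - indicator U x\<bar> \<le> r / 2"
        by (intro near) simp
      then have "\<forall>\<^sub>F n in sequentially. norm (p n x - indicator U x) < r"
      proof eventually_elim
        case (elim n)
        have "p n x - indicator U x = (\<Sum>k<Suc n. f n ((\<Psi> n ^^ Suc k) x) - indicator U x) / real (Suc n)"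
          unfolding p_def by (simp add: sum_subtractf diff_divide_distrib del: funpow.simps sum.lessThan_Suc of_nat_Suc)
        moreover have "\<bar>\<Sum>k<Suc n. f n ((\<Psi> n ^^ Suc k) x) - indicator U x\<bar> \<le> (\<Sum>k<Suc n. r / 2)"
          by (rule order_trans[OF sum_abs], rule sum_mono) (use elim in \<open>auto simp del: funpow.simps\<close>)
        then have "\<bar>\<Sum>k<Suc n. f n ((\<Psi> n ^^ Suc k) x) - indicator U x\<bar> / real (Suc n) \<le> real (Suc n) * (r / 2) / real (Suc n)"
          by (intro divide_right_mono) auto
        ultimately have "norm (p n x - indicator U x) \<le> real (Suc n) * (r / 2) / real (Suc n)"
          by (simp only: real_norm_def abs_divide abs_of_nat)
        then show ?case using \<open>r > 0\<close> by (simp del: of_nat_Suc)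
      qed
      then show "\<exists>no. \<forall>n\<ge>no. norm (p n x - indicator U x) < r" by (simp add: eventually_sequentially)
    qed
    have "(\<Sum>j\<leftarrow>js. partial j v x $ j) = (\<Sum>j\<in>UNIV. partial j v x $ j)" for x
      using js by (simp add: sum_list_distinct_conv_sum_set)
    then show "AE x in lborel. (\<lambda>n. p n x * (real (Suc n) * (J n x - 1))) \<longlonglongrightarrow>
        indicator U x * (\<Sum>j\<in>UNIV. partial j v x $ j)"
      using shears_jacobian_expansion_list[OF tendsto_const, where js = js]
      by (intro AE_I2 tendsto_mult p_lim) (simp add: J_def)
  qed
  ultimately show ?thesis using LIMSEQ_unique by fastforce
qed

end

section \<open>Regular trajectories\<close>

text \<open>
  A class of trajectories that contains the integral curves of the control fields, is closed under
  concatenation, and has controls that are square integrable for an elementary reason: they are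
  bounded, and continuous except at finitely many times.
\<close>

definition regular_trajectory ::
    "(real^'d) set \<Rightarrow> nat \<Rightarrow> (nat \<Rightarrow> real^'d \<Rightarrow> real^'d) \<Rightarrow> (real \<Rightarrow> real^'d) \<Rightarrow> bool"
  where "regular_trajectory \<Omega> m g \<gamma> \<longleftrightarrow>
    (\<exists>L. L-lipschitz_on {0..1} \<gamma>) \<and> \<gamma> ` {0..1} \<subseteq> \<Omega> \<and>
    (\<exists>S u C. finite S \<and> (\<forall>i t. \<bar>u i t\<bar> \<le> C) \<and>
      (\<forall>t\<in>{0<..<1} - S. (\<forall>i<m. isCont (u i) t) \<and>
        (\<gamma> has_vector_derivative (\<Sum>i<m. u i t *\<^sub>R g i (\<gamma> t))) (at t)))"

lemma L2_fun_if_continuous_bounded: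
  fixes F :: "real \<Rightarrow> 'b::euclidean_space"
  assumes "finite S" and c: "continuous_on ({0<..<1} - S) F" and b: "\<And>t. t \<in> {0<..<1} - S \<Longrightarrow> norm (F t) \<le> C"
  shows "F \<in> L2_fun (lebesgue_on {0<..<1})"
proof -
  define T where "T = {0<..<1} - S"
  have T: "T \<in> sets borel"
    using \<open>finite S\<close> unfolding T_def by (intro sets.Diff borel_open borel_closed finite_imp_closed) auto
  have [measurable]: "(\<lambda>t. indicator T t *\<^sub>R F t) \<in> borel_measurable borel"
    using borel_measurable_continuous_on_indicator[OF T] c by (simp add: T_def)
  have [measurable]: "{s} \<in> sets borel" for s :: real by simp
  have "(\<lambda>t. indicator T t *\<^sub>R F t + (\<Sum>s\<in>S. indicator {s} t *\<^sub>R F s)) \<in> borel_measurable (lebesgue_on {0<..<1})"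
    by (intro measurable_restrict_space1 measurable_completion) simp
  moreover have "indicator T t *\<^sub>R F t + (\<Sum>s\<in>S. indicator {s} t *\<^sub>R F s) = F t" if "t \<in> {0<..<1}" for t
  proof (cases "t \<in> S")
    case True
    have "(\<Sum>s\<in>S. indicator {s} t *\<^sub>R F s) = (\<Sum>s\<in>{t}. indicator {s} t *\<^sub>R F s)"
      using True \<open>finite S\<close> by (intro sum.mono_neutral_right) (auto simp: indicator_def)
    then show ?thesis using True by (simp add: T_def)
  next
    case False
    then have "(\<Sum>s\<in>S. indicator {s} t *\<^sub>R F s) = 0" by (intro sum.neutral) (auto simp: indicator_def)
    then show ?thesis using False that by (simp add: T_def)
  qed
  ultimately have m: "F \<in> borel_measurable (lebesgue_on {0<..<1})"
    by (subst measurable_cong[where g = "\<lambda>t. indicator T t *\<^sub>R F t + (\<Sum>s\<in>S. indicator {s} t *\<^sub>R F s)"]) auto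
  have "integrable (lebesgue_on {0<..<1}) (\<lambda>t. (norm (F t))\<^sup>2)"
  proof (rule finite_measure.integrable_const_bound)
    show "finite_measure (lebesgue_on {0<..<1::real})"
      by (rule finite_measure_lebesgue_on) simp
    \<comment> \<open>The sum bounds the arbitrary values at the exceptional times.\<close>
    define B where "B = \<bar>C\<bar> + (\<Sum>s\<in>S. norm (F s))"
    have "norm (F t) \<le> B" if "t \<in> {0<..<1}" for t
    proof (cases "t \<in> S")
      case True
      then show ?thesis using member_le_sum[of t S "\<lambda>s. norm (F s)"] \<open>finite S\<close> by (auto simp: B_def)
    next
      case False
      have "0 \<le> (\<Sum>s\<in>S. norm (F s))" by (intro sum_nonneg) auto
      then show ?thesis using b[of t] that False by (simp add: B_def)
    qed
    then show "AE t in lebesgue_on {0<..<1}. norm ((norm (F t))\<^sup>2) \<le> B\<^sup>2"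
      by (intro AE_I2) (simp add: power_mono)
    show "(\<lambda>t. (norm (F t))\<^sup>2) \<in> borel_measurable (lebesgue_on {0<..<1})" using m by measurable
  qed
  with m show ?thesis by (simp add: L2_fun_def)
qed

lemma lipschitz_imp_absolutely_continuous_curve:
  assumes "L-lipschitz_on {a..b} \<gamma>"
  shows "absolutely_continuous_curve a b \<gamma>"
  unfolding absolutely_continuous_curve_def
proof (intro allI impI)
  fix \<epsilon> :: real assume "\<epsilon> > 0"
  have L: "L \<ge> 0" by (rule lipschitz_on_nonneg[OF assms])
  have *: "(\<Sum>k<n. dist (\<gamma> (s k)) (\<gamma> (t k))) < \<epsilon>"
    if st: "\<forall>k<n. a \<le> s k \<and> s k \<le> t k \<and> t k \<le> b" and d: "(\<Sum>k<n. t k - s k) < \<epsilon> / (L + 1)"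
    for n :: nat and s t
  proof -
    have "(\<Sum>k<n. dist (\<gamma> (s k)) (\<gamma> (t k))) \<le> (\<Sum>k<n. L * (t k - s k))"
    proof (rule sum_mono)
      fix k assume "k \<in> {..<n}"
      then have "a \<le> s k" "s k \<le> t k" "t k \<le> b" using st by auto
      then show "dist (\<gamma> (s k)) (\<gamma> (t k)) \<le> L * (t k - s k)"
        using lipschitz_onD[OF assms, of "s k" "t k"] by (simp add: dist_real_def)
    qed
    also have "\<dots> = L * (\<Sum>k<n. t k - s k)" by (simp add: sum_distrib_left)
    also have "\<dots> \<le> L * (\<epsilon> / (L + 1))" using d L by (intro mult_left_mono) auto
    also have "\<dots> < \<epsilon>"
      using L \<open>\<epsilon> > 0\<close> mult_strict_left_mono[of "L / (L + 1)" 1 \<epsilon>] by (simp add: mult.commute)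
    finally show ?thesis .
  qed
  \<comment> \<open>The summand 1 covers the case \<open>L = 0\<close>.\<close>
  show "\<exists>\<delta>>0. \<forall>(n::nat) s t. (\<forall>k<n. a \<le> s k \<and> s k \<le> t k \<and> t k \<le> b) \<and>
      disjoint_family_on (\<lambda>k. {s k<..<t k}) {..<n} \<and> (\<Sum>k<n. t k - s k) < \<delta> \<longrightarrow>
      (\<Sum>k<n. dist (\<gamma> (s k)) (\<gamma> (t k))) < \<epsilon>"
  proof (intro exI[of _ "\<epsilon> / (L + 1)"] conjI allI impI)
    show "0 < \<epsilon> / (L + 1)" using \<open>\<epsilon> > 0\<close> L by simp
  qed (rule *; simp)
qed

lemma regular_trajectory_imp_trajectory:
  assumes reg: "regular_trajectory \<Omega> m g \<gamma>" and g: "\<And>i. i < m \<Longrightarrow> continuous_on \<Omega> (g i)"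
  shows "trajectory \<Omega> m g \<gamma>"
proof -
  obtain L S u C where L: "L-lipschitz_on {0..1} \<gamma>" and im: "\<gamma> ` {0..1} \<subseteq> \<Omega>"
    and S: "finite S" and C: "\<forall>i t. \<bar>u i t\<bar> \<le> C"
    and D: "\<forall>t\<in>{0<..<1} - S. (\<forall>i<m. isCont (u i) t) \<and>
        (\<gamma> has_vector_derivative (\<Sum>i<m. u i t *\<^sub>R g i (\<gamma> t))) (at t)"
    using reg unfolding regular_trajectory_def by (elim conjE exE)
  note C = C[rule_format]
  have u: "isCont (u i) t" if "t \<in> {0<..<1} - S" "i < m" for i t using D that by simp
  have D: "(\<gamma> has_vector_derivative (\<Sum>i<m. u i t *\<^sub>R g i (\<gamma> t))) (at t)"
    if "t \<in> {0<..<1} - S" for t using D that by simp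
  have c\<gamma>: "continuous_on {0..1} \<gamma>" by (rule lipschitz_on_continuous_on[OF L])
  have cu: "continuous_on ({0<..<1} - S) (u i)" if "i < m" for i
    using u that continuous_at_imp_continuous_on by blast
  have cg: "continuous_on {0..1} (\<lambda>t. g i (\<gamma> t))" if "i < m" for i
    by (rule continuous_on_compose2[OF g[OF that] c\<gamma> im])
  have "\<exists>B. i < m \<longrightarrow> (\<forall>t\<in>{0..1}. norm (g i (\<gamma> t)) \<le> B)" for i
  proof (cases "i < m")
    case True
    have "bounded ((\<lambda>t. g i (\<gamma> t)) ` {0..1})"
      by (rule compact_imp_bounded[OF compact_continuous_image[OF cg[OF True] compact_Icc]])
    then show ?thesis unfolding bounded_iff by blast
  qed simp
  then obtain B where B: "\<And>i t. i < m \<Longrightarrow> t \<in> {0..1} \<Longrightarrow> norm (g i (\<gamma> t)) \<le> B i"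
    using choice[of "\<lambda>i B. i < m \<longrightarrow> (\<forall>t\<in>{0..1}. norm (g i (\<gamma> t)) \<le> B)"] by blast
  have C0: "0 \<le> C" using C[of 0 0] by linarith
  have "(\<lambda>t. vector_derivative \<gamma> (at t)) \<in> L2_fun (lebesgue_on {0<..<1})"
  proof (rule L2_fun_if_continuous_bounded[OF S, of _ "\<Sum>i<m. C * B i"])
    have eq: "vector_derivative \<gamma> (at t) = (\<Sum>i<m. u i t *\<^sub>R g i (\<gamma> t))" if "t \<in> {0<..<1} - S" for t
      using D[OF that] by (rule vector_derivative_at)
    have "continuous_on ({0<..<1} - S) (\<lambda>t. \<Sum>i<m. u i t *\<^sub>R g i (\<gamma> t))"
      by (intro continuous_intros cu continuous_on_subset[OF cg]) auto
    then show "continuous_on ({0<..<1} - S) (\<lambda>t. vector_derivative \<gamma> (at t))"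
      by (subst continuous_on_cong[OF refl eq])
    show "norm (vector_derivative \<gamma> (at t)) \<le> (\<Sum>i<m. C * B i)" if "t \<in> {0<..<1} - S" for t
      unfolding eq[OF that]
    proof (rule sum_norm_le)
      fix i assume "i \<in> {..<m}"
      then have "norm (g i (\<gamma> t)) \<le> B i" using B that by auto
      then show "norm (u i t *\<^sub>R g i (\<gamma> t)) \<le> C * B i"
        using mult_mono[OF C[of i t] _ C0] by simp
    qed
  qed
  moreover have "u i \<in> L2_fun (lebesgue_on {0<..<1})" if "i < m" for i
    using C by (intro L2_fun_if_continuous_bounded[OF S cu[OF that], of C]) auto
  moreover have "AE t in lebesgue_on {0<..<1}. (\<gamma> has_vector_derivative (\<Sum>i<m. u i t *\<^sub>R g i (\<gamma> t))) (at t)"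
  proof -
    have "S \<in> null_sets lborel" using S by (rule finite_imp_null_set_lborel)
    then have "AE t in lborel. t \<notin> S" by (rule AE_not_in)
    then have "AE t in lebesgue. t \<notin> S" by (rule AE_completion)
    then have "AE t in lebesgue_on {0<..<1}. t \<notin> S" by (subst AE_restrict_space_iff) auto
    moreover have "AE t in lebesgue_on {0<..<1::real}. t \<in> {0<..<1}" by (rule AE_I2) simp
    ultimately show ?thesis by eventually_elim (use D in auto)
  qed
  ultimately show ?thesis
    unfolding trajectory_def
    by (intro conjI exI[of _ u] lipschitz_imp_absolutely_continuous_curve[OF L]) (use im in auto)
qed

lemma regular_trajectory_const:
  assumes "x \<in> \<Omega>"
  shows "regular_trajectory \<Omega> m g (\<lambda>t. x)"
proof -
  have "0-lipschitz_on {0..1} (\<lambda>t::real. x)" by (rule lipschitz_onI) auto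
  moreover have "((\<lambda>t. x) has_vector_derivative (\<Sum>i<m. (\<lambda>i t. 0) i t *\<^sub>R g i x)) (at t)" for t :: real
    by simp
  ultimately show ?thesis
    unfolding regular_trajectory_def using assms
    by (intro conjI exI[of _ "0::real"] exI[of _ "{} :: real set"] exI[of _ "\<lambda>(i::nat) (t::real). 0::real"]) auto
qed

text \<open>
  Each piece is run at double speed, hence with doubled controls. The junction $1/2$ joins the
  exceptional times.
\<close>

lemma regular_trajectory_concat:
  assumes r1: "regular_trajectory \<Omega> m g \<gamma>" and r2: "regular_trajectory \<Omega> m g \<eta>" and j: "\<gamma> 1 = \<eta> 0"
  shows "regular_trajectory \<Omega> m g (\<lambda>t. if t \<le> 1 / 2 then \<gamma> (2 * t) else \<eta> (2 * t - 1))"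
    (is "regular_trajectory _ _ _ ?\<alpha>")
proof -
  obtain L S u C where L: "L-lipschitz_on {0..1} \<gamma>" and im: "\<gamma> ` {0..1} \<subseteq> \<Omega>"
    and S: "finite S" and C: "\<forall>i t. \<bar>u i t\<bar> \<le> C"
    and D: "\<forall>t\<in>{0<..<1} - S. (\<forall>i<m. isCont (u i) t) \<and>
        (\<gamma> has_vector_derivative (\<Sum>i<m. u i t *\<^sub>R g i (\<gamma> t))) (at t)"
    using r1 unfolding regular_trajectory_def by (elim conjE exE)
  note C = C[rule_format]
  have u: "isCont (u i) t" if "t \<in> {0<..<1} - S" "i < m" for i t using D that by simp
  have D: "(\<gamma> has_vector_derivative (\<Sum>i<m. u i t *\<^sub>R g i (\<gamma> t))) (at t)"
    if "t \<in> {0<..<1} - S" for t using D that by simp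
  obtain L' S' u' C' where L': "L'-lipschitz_on {0..1} \<eta>" and im': "\<eta> ` {0..1} \<subseteq> \<Omega>"
    and S': "finite S'" and C': "\<forall>i t. \<bar>u' i t\<bar> \<le> C'"
    and D': "\<forall>t\<in>{0<..<1} - S'. (\<forall>i<m. isCont (u' i) t) \<and>
        (\<eta> has_vector_derivative (\<Sum>i<m. u' i t *\<^sub>R g i (\<eta> t))) (at t)"
    using r2 unfolding regular_trajectory_def by (elim conjE exE)
  note C' = C'[rule_format]
  have u': "isCont (u' i) t" if "t \<in> {0<..<1} - S'" "i < m" for i t using D' that by simp
  have D': "(\<eta> has_vector_derivative (\<Sum>i<m. u' i t *\<^sub>R g i (\<eta> t))) (at t)"
    if "t \<in> {0<..<1} - S'" for t using D' that by simp
  define w where "w i t = (if t \<le> 1 / 2 then 2 * u i (2 * t) else 2 * u' i (2 * t - 1))" for i and t :: real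
  define Q where "Q = {1 / 2} \<union> (\<lambda>s. s / 2) ` S \<union> (\<lambda>s. (s + 1) / 2) ` S'"
  have dist2: "dist (2 * s - c) (2 * t - c) = 2 * dist s t" for s t c :: real
    by (simp add: dist_real_def abs_if)
  have "(max (2 * L) (2 * L'))-lipschitz_on {0..1} ?\<alpha>"
  proof (rule lipschitz_on_concat_max)
    show "(2 * L)-lipschitz_on {0..1/2} (\<lambda>t. \<gamma> (2 * t))"
    proof (rule lipschitz_onI)
      fix s t :: real assume "s \<in> {0..1/2}" "t \<in> {0..1/2}"
      then show "dist (\<gamma> (2 * s)) (\<gamma> (2 * t)) \<le> 2 * L * dist s t"
        using lipschitz_onD[OF L, of "2 * s" "2 * t"] dist2[of s 0 t] by (simp add: mult.assoc)
    qed (use lipschitz_on_nonneg[OF L] in simp)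
    show "(2 * L')-lipschitz_on {1/2..1} (\<lambda>t. \<eta> (2 * t - 1))"
    proof (rule lipschitz_onI)
      fix s t :: real assume "s \<in> {1/2..1}" "t \<in> {1/2..1}"
      then show "dist (\<eta> (2 * s - 1)) (\<eta> (2 * t - 1)) \<le> 2 * L' * dist s t"
        using lipschitz_onD[OF L', of "2 * s - 1" "2 * t - 1"] dist2[of s 1 t] by (simp add: mult.assoc)
    qed (use lipschitz_on_nonneg[OF L'] in simp)
  qed (use j in simp)
  moreover have "?\<alpha> ` {0..1} \<subseteq> \<Omega>" using im im' by (auto simp: image_subset_iff)
  moreover have "finite Q" using S S' by (simp add: Q_def)
  moreover have "\<bar>w i t\<bar> \<le> 2 * max C C'" for i t
    using C[of i "2 * t"] C'[of i "2 * t - 1"] by (auto simp: w_def abs_mult)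
  moreover have "(\<forall>i<m. isCont (w i) t) \<and> (?\<alpha> has_vector_derivative (\<Sum>i<m. w i t *\<^sub>R g i (?\<alpha> t))) (at t)"
    if t: "t \<in> {0<..<1} - Q" for t
  proof (cases "t < 1 / 2")
    case True
    have "2 * t \<notin> S"
    proof
      assume "2 * t \<in> S"
      then have "2 * t / 2 \<in> (\<lambda>s. s / 2) ` S" by (rule imageI)
      then show False using t by (simp add: Q_def)
    qed
    then have t2: "2 * t \<in> {0<..<1} - S" using t True by auto
    have "isCont (w i) t" if "i < m" for i
    proof -
      have "isCont (\<lambda>t. 2 * u i (2 * t)) t"
      proof -
        have "isCont (\<lambda>t::real. 2 * t) t" by (intro continuous_intros)
        from isCont_o2[OF this u[OF t2 that]] show ?thesis by (intro continuous_intros)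
      qed
      moreover have "eventually (\<lambda>t. w i t = 2 * u i (2 * t)) (nhds t)"
        using eventually_nhds_in_open[of "{..<1/2}" t] True by (auto simp: w_def elim!: eventually_mono)
      ultimately show ?thesis using isCont_cong[of "w i" "\<lambda>t. 2 * u i (2 * t)" t] by blast
    qed
    moreover have "((\<lambda>t. \<gamma> (2 * t)) has_vector_derivative 2 *\<^sub>R (\<Sum>i<m. u i (2 * t) *\<^sub>R g i (\<gamma> (2 * t)))) (at t)"
    proof -
      have "((*) 2 has_vector_derivative 2) (at t)"
        unfolding has_real_derivative_iff_has_vector_derivative[symmetric]
        by (auto intro!: derivative_eq_intros)
      from vector_diff_chain_at[OF this D[OF t2]] show ?thesis by (simp add: o_def)
    qed
    then have "(?\<alpha> has_vector_derivative 2 *\<^sub>R (\<Sum>i<m. u i (2 * t) *\<^sub>R g i (\<gamma> (2 * t)))) (at t)"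
      by (rule has_vector_derivative_transform_within_open[of _ _ _ "{..<1/2}"]) (use True in auto)
    then have "(?\<alpha> has_vector_derivative (\<Sum>i<m. w i t *\<^sub>R g i (?\<alpha> t))) (at t)"
      using True by (simp add: w_def scaleR_sum_right)
    ultimately show ?thesis by blast
  next
    case False
    then have t1: "t > 1 / 2" using t by (auto simp: Q_def)
    have "2 * t - 1 \<notin> S'"
    proof
      assume "2 * t - 1 \<in> S'"
      then have "(2 * t - 1 + 1) / 2 \<in> (\<lambda>s. (s + 1) / 2) ` S'" by (rule imageI)
      then show False using t by (simp add: Q_def)
    qed
    then have t2: "2 * t - 1 \<in> {0<..<1} - S'" using t t1 by auto
    have "isCont (w i) t" if "i < m" for i
    proof -
      have "isCont (\<lambda>t. 2 * u' i (2 * t - 1)) t"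
      proof -
        have "isCont (\<lambda>t::real. 2 * t - 1) t" by (intro continuous_intros)
        from isCont_o2[OF this u'[OF t2 that]] show ?thesis by (intro continuous_intros)
      qed
      moreover have "eventually (\<lambda>t. w i t = 2 * u' i (2 * t - 1)) (nhds t)"
        using eventually_nhds_in_open[of "{1/2<..}" t] t1 by (auto simp: w_def elim!: eventually_mono)
      ultimately show ?thesis using isCont_cong[of "w i" "\<lambda>t. 2 * u' i (2 * t - 1)" t] by blast
    qed
    moreover have "((\<lambda>t. \<eta> (2 * t - 1)) has_vector_derivative 2 *\<^sub>R (\<Sum>i<m. u' i (2 * t - 1) *\<^sub>R g i (\<eta> (2 * t - 1)))) (at t)"
    proof -
      have "((\<lambda>t. 2 * t - 1) has_vector_derivative 2) (at t)"
        unfolding has_real_derivative_iff_has_vector_derivative[symmetric]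
        by (auto intro!: derivative_eq_intros)
      from vector_diff_chain_at[OF this D'[OF t2]] show ?thesis by (simp add: o_def)
    qed
    then have "(?\<alpha> has_vector_derivative 2 *\<^sub>R (\<Sum>i<m. u' i (2 * t - 1) *\<^sub>R g i (\<eta> (2 * t - 1)))) (at t)"
      by (rule has_vector_derivative_transform_within_open[of _ _ _ "{1/2<..}"]) (use t1 in auto)
    then have "(?\<alpha> has_vector_derivative (\<Sum>i<m. w i t *\<^sub>R g i (?\<alpha> t))) (at t)"
      using t1 by (simp add: w_def scaleR_sum_right)
    ultimately show ?thesis by blast
  qed
  ultimately show ?thesis
    unfolding regular_trajectory_def
    by (intro conjI exI[of _ "max (2 * L) (2 * L')"] exI[of _ Q] exI[of _ w] exI[of _ "2 * max C C'"] allI ballI)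
       simp_all
qed

section \<open>Invariance of the reaching set\<close>

text \<open>
  With $a = 0$ and $b = t$ this is the restriction to $[0, t]$; with $a = t$ and $b = -t$ it is the
  same piece run backwards.
\<close>

lemma integral_curve_reparametrize:
  assumes g: "integral_curve v \<gamma>" and a: "a \<in> {0..1}" "a + b \<in> {0..1}"
  shows "integral_curve (\<lambda>x. b *\<^sub>R v x) (\<lambda>s. \<gamma> (a + b * s))"
  unfolding integral_curve_def
proof
  fix s :: real assume s: "s \<in> {0..1}"
  have img: "(\<lambda>s. a + b * s) ` {0..1} \<subseteq> {0..1}"
  proof
    fix r assume "r \<in> (\<lambda>s. a + b * s) ` {0..1}"
    then obtain s where s: "s \<in> {0..1}" "r = (1 - s) * a + s * (a + b)"
      by (auto simp: algebra_simps)
    then have "r \<in> closed_segment a (a + b)" by (auto simp: in_segment)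
    also have "\<dots> \<subseteq> {0..1}" using a by (intro closed_segment_subset) auto
    finally show "r \<in> {0..1}" .
  qed
  have "((\<lambda>s. a + b * s) has_vector_derivative b) (at s within {0..1})"
    unfolding has_real_derivative_iff_has_vector_derivative[symmetric]
    by (auto intro!: derivative_eq_intros)
  moreover have "(\<gamma> has_vector_derivative v (\<gamma> (a + b * s))) (at (a + b * s) within (\<lambda>s. a + b * s) ` {0..1})"
  proof (rule has_vector_derivative_within_subset[OF _ img])
    have "a + b * s \<in> {0..1}" using img s by blast
    then show "(\<gamma> has_vector_derivative v (\<gamma> (a + b * s))) (at (a + b * s) within {0..1})"
      using g by (simp add: integral_curve_def)
  qed
  ultimately show "((\<lambda>s. \<gamma> (a + b * s)) has_vector_derivative b *\<^sub>R v (\<gamma> (a + b * s))) (at s within {0..1})"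
    using vector_diff_chain_within by (fastforce simp: o_def)
qed

text \<open>
  Fields $\psi g_i$ parallel to a control field, whose integral curves that start in the domain are
  trajectories of the control system, with control $u_i = \psi \circ \gamma$.
\<close>

locale steering_field =
  fixes \<Omega> :: "(real^'d) set" and m :: nat and g :: "nat \<Rightarrow> real^'d \<Rightarrow> real^'d"
    and i :: nat and \<psi> :: "real^'d \<Rightarrow> real"
  assumes i: "i < m" and cont_\<psi>: "continuous_on UNIV \<psi>"
    and supp: "\<And>x. x \<notin> \<Omega> \<Longrightarrow> \<psi> x = 0"
    and bounded_\<psi>: "bounded (range \<psi>)"
    and bounded_field: "bounded (range (\<lambda>x. \<psi> x *\<^sub>R g i x))"
    and lip: "\<And>x y. norm (\<psi> x *\<^sub>R g i x - \<psi> y *\<^sub>R g i y) \<le> 1 / 2 * norm (x - y)"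
begin

abbreviation v :: "real^'d \<Rightarrow> real^'d" where "v x \<equiv> \<psi> x *\<^sub>R g i x"

lemma steering_field_scale:
  assumes "\<bar>c\<bar> \<le> 1"
  shows "steering_field \<Omega> m g i (\<lambda>x. c * \<psi> x)"
proof
  show "bounded (range (\<lambda>x. c * \<psi> x))"
    using bounded_scaling[OF bounded_\<psi>, of c] by (simp add: image_image)
  show "bounded (range (\<lambda>x. (c * \<psi> x) *\<^sub>R g i x))"
    using bounded_scaling[OF bounded_field, of c] by (simp add: image_image)
  fix x y
  have "norm ((c * \<psi> x) *\<^sub>R g i x - (c * \<psi> y) *\<^sub>R g i y) = \<bar>c\<bar> * norm (v x - v y)"
    by (simp flip: scaleR_scaleR scaleR_diff_right)
  also have "\<dots> \<le> 1 * norm (v x - v y)" using assms by (intro mult_right_mono) auto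
  finally show "norm ((c * \<psi> x) *\<^sub>R g i x - (c * \<psi> y) *\<^sub>R g i y) \<le> 1 / 2 * norm (x - y)"
    using lip[of x y] by linarith
qed (use i supp in \<open>auto intro!: continuous_intros cont_\<psi>\<close>)

text \<open>
  Outside the domain the field vanishes, so a curve that leaves the domain is constant.
\<close>

lemma integral_curve_in_domain:
  assumes "integral_curve v \<gamma>" "s \<in> {0..1}" "\<gamma> s \<in> \<Omega>" "t \<in> {0..1}"
  shows "\<gamma> t \<in> \<Omega>"
proof (rule ccontr)
  assume "\<gamma> t \<notin> \<Omega>"
  then have "v (\<gamma> t) = 0" using supp by simp
  then have "\<gamma> s = \<gamma> t" using integral_curve_stationary[of v \<gamma> t s] lip assms by blast
  then show False using \<open>\<gamma> t \<notin> \<Omega>\<close> assms by simp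
qed

lemma integral_curve_regular_trajectory:
  assumes c: "integral_curve v \<gamma>" and "\<gamma> 0 \<in> \<Omega>"
  shows "regular_trajectory \<Omega> m g \<gamma>"
proof -
  define u where "u j t = (if j = i then \<psi> (\<gamma> t) else 0)" for j and t :: real
  obtain M where M: "\<And>x. norm (v x) \<le> M" using bounded_field by (auto simp: bounded_iff)
  obtain C where C: "\<And>x. \<bar>\<psi> x\<bar> \<le> C" using bounded_\<psi> by (auto simp: bounded_iff)
  have "M-lipschitz_on {0..1} \<gamma>"
  proof (rule lipschitz_onI)
    show "dist (\<gamma> s) (\<gamma> t) \<le> M * dist s t" if "s \<in> {0..1}" "t \<in> {0..1}" for s t
      using norm_diff_le_if_vector_derivative_le[of "{0..1}" \<gamma> "\<lambda>t. v (\<gamma> t)" M t s] c M that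
      by (auto simp: integral_curve_def dist_norm)
    show "0 \<le> M" using M[of 0] norm_ge_zero order_trans by blast
  qed
  moreover have "\<gamma> ` {0..1} \<subseteq> \<Omega>"
    using integral_curve_in_domain[OF c, of 0] assms(2) by auto
  moreover have "\<bar>u j t\<bar> \<le> C" for j t
    using C[of "\<gamma> t"] order_trans[OF abs_ge_zero C] by (simp add: u_def)
  moreover have "(\<forall>j<m. isCont (u j) t) \<and> (\<gamma> has_vector_derivative (\<Sum>j<m. u j t *\<^sub>R g j (\<gamma> t))) (at t)"
    if t: "t \<in> {0<..<1} - {}" for t
  proof -
    have D: "(\<gamma> has_vector_derivative v (\<gamma> t)) (at t)"
    proof -
      have "(\<gamma> has_vector_derivative v (\<gamma> t)) (at t within {0..1})"
        using c t by (simp add: integral_curve_def)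
      then show ?thesis using at_within_Icc_at[of 0 t 1] t by simp
    qed
    have "isCont (\<lambda>t. \<psi> (\<gamma> t)) t"
    proof -
      have "isCont \<gamma> t" using D by (rule has_vector_derivative_continuous)
      moreover have "isCont \<psi> (\<gamma> t)" using cont_\<psi> by (simp add: continuous_on_eq_continuous_at)
      ultimately show ?thesis by (rule isCont_o2)
    qed
    then have "isCont (u j) t" for j by (cases "j = i") (simp_all add: u_def[abs_def])
    moreover have "(\<Sum>j<m. u j t *\<^sub>R g j (\<gamma> t)) = (\<Sum>j\<in>{i}. u j t *\<^sub>R g j (\<gamma> t))"
      using i by (intro sum.mono_neutral_right) (auto simp: u_def)
    ultimately show ?thesis using D by (simp add: u_def)
  qed
  ultimately show ?thesis
    unfolding regular_trajectory_def
    by (intro conjI exI[of _ M] exI[of _ "{} :: real set"] exI[of _ u] exI[of _ C] allI ballI) simp_all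
qed

end

definition regularly_reaching ::
    "(real^'d) set \<Rightarrow> nat \<Rightarrow> (nat \<Rightarrow> real^'d \<Rightarrow> real^'d) \<Rightarrow> (real^'d) set \<Rightarrow> (real^'d) set"
  where "regularly_reaching \<Omega> m g B =
    {x \<in> \<Omega>. \<exists>\<gamma>. regular_trajectory \<Omega> m g \<gamma> \<and> \<gamma> 0 = x \<and> \<gamma> 1 \<in> B}"

context steering_field
begin

text \<open>
  Points near $\alpha(0)$ are carried to points near $\alpha(1)$, from where the target is reached;
  concatenation gives trajectories from all of them.
\<close>

lemma interior_regularly_reaching_pull_back:
  assumes "open \<Omega>" and \<alpha>: "integral_curve v \<alpha>" "\<alpha> 0 \<in> \<Omega>"
    and target: "\<alpha> 1 \<in> interior (regularly_reaching \<Omega> m g B)"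
  shows "\<alpha> 0 \<in> interior (regularly_reaching \<Omega> m g B)"
proof -
  obtain e where e: "e > 0" "ball (\<alpha> 1) e \<subseteq> regularly_reaching \<Omega> m g B"
    using target unfolding mem_interior by blast
  obtain r where r: "r > 0" "ball (\<alpha> 0) r \<subseteq> \<Omega>" using assms(1) \<alpha>(2) open_contains_ball by blast
  have "ball (\<alpha> 0) (min r (e / 2)) \<subseteq> regularly_reaching \<Omega> m g B"
  proof
    fix x assume x: "x \<in> ball (\<alpha> 0) (min r (e / 2))"
    then have x\<Omega>: "x \<in> \<Omega>" using r by auto
    obtain \<beta> where \<beta>: "integral_curve v \<beta>" "\<beta> 0 = x" using integral_curve_exists[of v x] lip by blast
    have "norm (\<alpha> 1 - \<beta> 1) \<le> 2 * norm (\<alpha> 0 - \<beta> 0)"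
      using integral_curves_close[OF lip \<alpha>(1) \<beta>(1), of 0 1] by simp
    also have "\<dots> < e" using x by (simp add: dist_norm \<beta>(2))
    finally have "\<beta> 1 \<in> regularly_reaching \<Omega> m g B" using e(2) by (auto simp: dist_norm)
    then obtain \<eta> where \<eta>: "regular_trajectory \<Omega> m g \<eta>" "\<eta> 0 = \<beta> 1" "\<eta> 1 \<in> B"
      by (auto simp: regularly_reaching_def)
    have "regular_trajectory \<Omega> m g \<beta>"
      using integral_curve_regular_trajectory[OF \<beta>(1)] \<beta>(2) x\<Omega> by simp
    from regular_trajectory_concat[OF this \<eta>(1) \<eta>(2)[symmetric]]
    show "x \<in> regularly_reaching \<Omega> m g B"
      unfolding regularly_reaching_def using x\<Omega> \<eta>(3) \<beta>(2)
      by (auto intro!: exI[of _ "\<lambda>t. if t \<le> 1 / 2 then \<beta> (2 * t) else \<eta> (2 * t - 1)"])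
  qed
  then show ?thesis unfolding mem_interior using e r by (metis min_less_iff_conj half_gt_zero)
qed

text \<open>
  Both directions reduce to the pull-back lemma, applied to the piece of $\gamma$ between $0$ and $t$ or to
  its reversal, which is an integral curve of $t \psi g_i$ or $-t \psi g_i$.
\<close>

lemma interior_regularly_reaching_invariant:
  assumes "open \<Omega>" and \<gamma>: "integral_curve v \<gamma>" and t: "t \<in> {0..1}"
  shows "\<gamma> 0 \<in> interior (regularly_reaching \<Omega> m g B) \<longleftrightarrow> \<gamma> t \<in> interior (regularly_reaching \<Omega> m g B)"
    (is "_ \<in> ?U \<longleftrightarrow> _")
proof
  have U\<Omega>: "?U \<subseteq> \<Omega>" using interior_subset by (auto simp: regularly_reaching_def)
  {
    assume "\<gamma> t \<in> ?U"
    interpret s: steering_field \<Omega> m g i "\<lambda>x. t * \<psi> x" using steering_field_scale[of t] t by simp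
    have "integral_curve s.v (\<lambda>s. \<gamma> (0 + t * s))"
      using integral_curve_reparametrize[OF \<gamma>, of 0 t] t by simp
    moreover have "\<gamma> 0 \<in> \<Omega>"
      using integral_curve_in_domain[OF \<gamma> t, of 0] U\<Omega> \<open>\<gamma> t \<in> ?U\<close> by auto
    ultimately show "\<gamma> 0 \<in> ?U"
      using s.interior_regularly_reaching_pull_back[OF assms(1), of "\<lambda>s. \<gamma> (0 + t * s)" B] \<open>\<gamma> t \<in> ?U\<close> by simp
  next
    assume "\<gamma> 0 \<in> ?U"
    interpret s: steering_field \<Omega> m g i "\<lambda>x. (- t) * \<psi> x" using steering_field_scale[of "- t"] t by simp
    have "integral_curve s.v (\<lambda>s. \<gamma> (t + (- t) * s))"
      using integral_curve_reparametrize[OF \<gamma>, of t "- t"] t by simp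
    moreover have "\<gamma> t \<in> \<Omega>"
      using integral_curve_in_domain[OF \<gamma> _ _ t, of 0] U\<Omega> \<open>\<gamma> 0 \<in> ?U\<close> by auto
    ultimately show "\<gamma> t \<in> ?U"
      using s.interior_regularly_reaching_pull_back[OF assms(1), of "\<lambda>s. \<gamma> (t + (- t) * s)" B] \<open>\<gamma> 0 \<in> ?U\<close> by simp
  }
qed

end

section \<open>Test functions times control fields\<close>

lemma partial_outside_support:
  assumes "closed K" "\<And>x. x \<notin> K \<Longrightarrow> f x = 0" "x \<notin> K"
  shows "(f has_derivative (\<lambda>h. 0)) (at x)" "partial j f x = 0"
proof -
  show D: "(f has_derivative (\<lambda>h. 0)) (at x)"
    by (rule has_derivative_transform_within_open[OF has_derivative_const, of "- K"]) (use assms in auto)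
  show "partial j f x = 0" by (simp add: partial_eqI[OF D])
qed

lemma partial_scaleR:
  assumes "f differentiable (at x)"
  shows "partial j (\<lambda>x. c *\<^sub>R f x) x = c *\<^sub>R partial j f x"
proof -
  obtain f' where "(f has_derivative f') (at x)" using assms by (auto simp: differentiable_def)
  then show ?thesis by (simp add: partial_eqI[OF has_derivative_scaleR_right] partial_eqI)
qed

lemma compact_support_C1_lipschitz:
  fixes v :: "real^'d \<Rightarrow> real^'d"
  assumes diff: "v differentiable_on UNIV" and cont: "\<And>j. continuous_on UNIV (partial j v)"
    and K: "compact K" "\<And>x. x \<notin> K \<Longrightarrow> v x = 0"
  obtains L where "L \<ge> 0" "\<And>x y. norm (v x - v y) \<le> L * norm (x - y)"
proof -
  have "\<exists>B. \<forall>x. norm (partial j v x) \<le> B" for j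
  proof -
    have "bounded (partial j v ` K)"
      using compact_imp_bounded[OF compact_continuous_image[OF continuous_on_subset[OF cont] K(1)]] by simp
    then obtain B where "B > 0" "\<And>x. x \<in> K \<Longrightarrow> norm (partial j v x) \<le> B" by (auto simp: bounded_pos)
    moreover have "partial j v x = 0" if "x \<notin> K" for x
      using partial_outside_support(2)[OF compact_imp_closed[OF K(1)] K(2) that] by simp
    ultimately have "norm (partial j v x) \<le> B" for x by (cases "x \<in> K") auto
    then show ?thesis by blast
  qed
  then obtain B where B: "\<And>j x. norm (partial j v x) \<le> B j"
    using choice[of "\<lambda>j B. \<forall>x. norm (partial j v x) \<le> B"] by blast
  define L where "L = (\<Sum>j\<in>UNIV. B j)"
  have B0: "B j \<ge> 0" for j using B[of j 0] norm_ge_zero order_trans by blast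
  have D: "(v has_derivative frechet_derivative v (at x)) (at x)" for x
    using diff by (auto simp: differentiable_on_def frechet_derivative_works)
  have "norm (frechet_derivative v (at x) h) \<le> L * norm h" for x h
  proof -
    have "frechet_derivative v (at x) h = frechet_derivative v (at x) (\<Sum>j\<in>UNIV. h $ j *\<^sub>R axis j 1)"
      using basis_expansion[of h] by (simp add: scalar_mult_eq_scaleR)
    also have "\<dots> = (\<Sum>j\<in>UNIV. h $ j *\<^sub>R partial j v x)"
      using has_derivative_linear[OF D] by (simp add: linear_sum linear_scale partial_def)
    also have "norm \<dots> \<le> (\<Sum>j\<in>UNIV. B j * norm h)"
    proof (rule sum_norm_le)
      fix j show "norm (h $ j *\<^sub>R partial j v x) \<le> B j * norm h"
        using mult_mono[OF component_le_norm_cart[of h j] B[of j x]] by (simp add: mult.commute)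
    qed
    finally show ?thesis by (simp add: L_def sum_distrib_right)
  qed
  then have "onorm (frechet_derivative v (at x)) \<le> L" for x by (rule onorm_le)
  then have "norm (v x - v y) \<le> L * norm (x - y)" for x y
    using differentiable_bound[of UNIV v "\<lambda>x. frechet_derivative v (at x)" L x y] D by simp
  moreover have "L \<ge> 0" using B0 by (simp add: L_def sum_nonneg)
  ultimately show ?thesis using that by blast
qed

lemma extends_continuously_imp_continuous_on:
  assumes "extends_continuously f S"
  shows "continuous_on S f"
proof -
  obtain F where F: "continuous_on (closure S) F" "\<And>x. x \<in> S \<Longrightarrow> F x = f x"
    using assms unfolding extends_continuously_def by blast
  have "continuous_on S F" using F(1) closure_subset by (rule continuous_on_subset)
  then show ?thesis by (rule continuous_on_eq) (rule F(2))
qed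

lemma test_function_support:
  assumes "\<phi> \<in> test_functions \<Omega>"
  shows "compact (closure {x. \<phi> x \<noteq> 0})" "closure {x. \<phi> x \<noteq> 0} \<subseteq> \<Omega>"
    "x \<notin> closure {x. \<phi> x \<noteq> 0} \<Longrightarrow> \<phi> x = 0"
  using assms closure_subset[of "{x. \<phi> x \<noteq> 0}"] unfolding test_functions_def by blast+

text \<open>
  The support of $\phi$ is compact in the open domain, so that $\phi g$, extended by zero, is of class
  $C^1$ on the whole space. Its divergence is $-X^*\phi$.
\<close>

lemma test_function_times_field:
  fixes g :: "real^'d \<Rightarrow> real^'d"
  assumes "open \<Omega>" and g: "C_k_closure 2 g \<Omega>" and \<phi>: "\<phi> \<in> test_functions \<Omega>"
  defines "v \<equiv> \<lambda>x. \<phi> x *\<^sub>R g x"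
  shows "v differentiable_on UNIV" "continuous_on UNIV (partial j v)"
    "X_adj g \<phi> x = - (\<Sum>j\<in>UNIV. partial j v x $ j)"
proof -
  define K where "K = closure {x. \<phi> x \<noteq> 0}"
  have K: "closed K" "K \<subseteq> \<Omega>" "\<And>x. x \<notin> K \<Longrightarrow> \<phi> x = 0"
    unfolding K_def by (rule closed_closure test_function_support[OF \<phi>], assumption?)+
  have v0: "v x = 0" if "x \<notin> K" for x using K(3)[OF that] by (simp add: v_def)
  have "C_k_on (Suc 0) \<phi> UNIV" using \<phi> by (auto simp: test_functions_def)
  then have \<phi>1: "\<phi> differentiable_on UNIV" "\<And>j. continuous_on UNIV (partial j \<phi>)" by auto
  have "C_k_closure (Suc (Suc 0)) g \<Omega>" using g by (simp add: numeral_2_eq_2)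
  then have g1: "g differentiable_on \<Omega>" "continuous_on \<Omega> g" "\<And>j. continuous_on \<Omega> (partial j g)"
    by (simp_all add: extends_continuously_imp_continuous_on)
  have D: "(v has_derivative (\<lambda>h. \<phi> x *\<^sub>R frechet_derivative g (at x) h + frechet_derivative \<phi> (at x) h *\<^sub>R g x)) (at x)"
    if "x \<in> \<Omega>" for x
  proof -
    have "(\<phi> has_derivative frechet_derivative \<phi> (at x)) (at x)"
      using \<phi>1 by (auto simp: differentiable_on_def frechet_derivative_works)
    moreover have "(g has_derivative frechet_derivative g (at x)) (at x)"
      using g1(1) differentiable_on_eq_differentiable_at[OF \<open>open \<Omega>\<close>] that by (auto simp: frechet_derivative_works)
    ultimately show ?thesis unfolding v_def by (rule has_derivative_scaleR)
  qed
  have diff: "v differentiable (at x)" for x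
  proof (cases "x \<in> \<Omega>")
    case True
    then show ?thesis using D unfolding differentiable_def by blast
  next
    case False
    then have "x \<notin> K" using K by blast
    then show ?thesis
      using partial_outside_support(1)[of K v x, OF K(1) v0] unfolding differentiable_def by blast
  qed
  then show "v differentiable_on UNIV" by (simp add: differentiable_on_def)
  have 1: "continuous_on \<Omega> (\<lambda>x. \<phi> x *\<^sub>R partial j g x + partial j \<phi> x *\<^sub>R g x)" for j
    by (intro continuous_intros g1 continuous_on_subset[OF \<phi>1(2)] continuous_on_subset[OF test_function_continuous[OF \<phi>]]) auto
  have 2: "\<phi> x *\<^sub>R partial j g x + partial j \<phi> x *\<^sub>R g x = partial j v x" if "x \<in> \<Omega>" for j x
    using partial_eqI[OF D[OF that], of j] by (simp add: partial_def)
  have "continuous_on \<Omega> (partial j v)" by (rule continuous_on_eq[OF 1 2])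
  moreover have "continuous_on (- K) (partial j v)"
  proof (rule continuous_on_eq[OF continuous_on_const])
    show "0 = partial j v x" if "x \<in> - K" for x
      using partial_outside_support(2)[of K v x j, OF K(1) v0] that by simp
  qed
  ultimately have "continuous_on (\<Omega> \<union> - K) (partial j v)"
    using \<open>open \<Omega>\<close> K(1) by (intro continuous_on_open_Un) auto
  moreover have "\<Omega> \<union> - K = UNIV" using K(2) by blast
  ultimately show "continuous_on UNIV (partial j v)" by simp
  have "partial j (\<lambda>z. g z $ j * \<phi> z) x = partial j v x $ j" for j
  proof -
    have "(v has_derivative frechet_derivative v (at x)) (at x)"
      using diff by (simp add: frechet_derivative_works)
    then have "((\<lambda>z. v z $ j) has_derivative (\<lambda>h. frechet_derivative v (at x) h $ j)) (at x)"
      by (rule bounded_linear.has_derivative[OF bounded_linear_vec_nth])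
    moreover have "(\<lambda>z. v z $ j) = (\<lambda>z. g z $ j * \<phi> z)" by (simp add: v_def mult.commute)
    ultimately show ?thesis using partial_eqI[of "\<lambda>z. v z $ j" _ x j] by (simp add: partial_def)
  qed
  then show "X_adj g \<phi> x = - (\<Sum>j\<in>UNIV. partial j v x $ j)" by (simp add: X_adj_def)
qed

text \<open>
  The divergence theorem for invariant sets, applied to a multiple $c\, \phi\, g_i$ that has Lipschitz
  constant at most $1/2$. Its integral curves in the domain are trajectories of the control
  system.
\<close>

lemma integral_X_adj_over_reaching_set:
  fixes g :: "nat \<Rightarrow> real^'d \<Rightarrow> real^'d"  and B :: "(real^'d) set"
  assumes \<Omega>: "open \<Omega>" "bounded \<Omega>" and i: "i < m" and g: "C_k_closure 2 (g i) \<Omega>"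
    and \<phi>: "\<phi> \<in> test_functions \<Omega>"
  defines "U \<equiv> interior (regularly_reaching \<Omega> m g B)"
  shows "(\<integral>x. indicator U x * X_adj (g i) \<phi> x \<partial>lborel) = 0"
proof -
  define v where "v x = \<phi> x *\<^sub>R g i x" for x
  note v = test_function_times_field[OF \<Omega>(1) g \<phi>, folded v_def]
  define K where "K = closure {x. \<phi> x \<noteq> 0}"
  have K: "compact K" "K \<subseteq> \<Omega>" "\<And>x. x \<notin> K \<Longrightarrow> \<phi> x = 0"
    unfolding K_def by (rule test_function_support[OF \<phi>], assumption?)+
  have v0: "v x = 0" if "x \<notin> K" for x using K(3)[OF that] by (simp add: v_def)
  obtain L where L: "L \<ge> 0" "\<And>x y. norm (v x - v y) \<le> L * norm (x - y)"
    using compact_support_C1_lipschitz[OF v(1,2) K(1) v0] by blast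
  \<comment> \<open>The summand 1 covers the case \<open>L = 0\<close>.\<close>
  define c where "c = 1 / (2 * (L + 1))"
  define w where "w x = c *\<^sub>R v x" for x
  have c: "c > 0" "c * L \<le> 1 / 2" using L(1) by (simp_all add: c_def field_simps)
  have diff: "v differentiable (at x)" for x using v(1) by (simp add: differentiable_on_def)
  have partial_w: "partial j w x = c *\<^sub>R partial j v x" for j x
    unfolding w_def by (rule partial_scaleR[OF diff])
  have lip: "norm (w x - w y) \<le> 1 / 2 * norm (x - y)" for x y
  proof -
    have "norm (w x - w y) = c * norm (v x - v y)"
      using c(1) by (simp add: w_def flip: scaleR_diff_right)
    also have "\<dots> \<le> c * (L * norm (x - y))" using L(2) c(1) by (intro mult_left_mono) auto
    also have "\<dots> = (c * L) * norm (x - y)" by simp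
    also have "\<dots> \<le> 1 / 2 * norm (x - y)" using c(2) by (intro mult_right_mono) auto
    finally show ?thesis .
  qed
  interpret w: compact_C1_field w K
  proof
    show "w differentiable_on UNIV"
      unfolding w_def differentiable_on_def using diff by (auto intro: differentiable_scaleR differentiable_const)
    have "partial j w = (\<lambda>x. c *\<^sub>R partial j v x)" for j using partial_w by blast
    then show "continuous_on UNIV (partial j w)" for j by (simp add: continuous_intros v(2))
  qed (use lip K(1) v0 in \<open>auto simp: w_def\<close>)
  have bdd: "bounded (range f)" if "continuous_on UNIV f" "\<And>x. x \<notin> K \<Longrightarrow> f x = 0"
    for f :: "real^'d \<Rightarrow> 'b::real_normed_vector"
  proof -
    have "bounded (insert 0 (f ` K))"
      using compact_imp_bounded[OF compact_continuous_image[OF continuous_on_subset[OF that(1)] K(1)]] by simp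
    moreover have "range f \<subseteq> insert 0 (f ` K)" using that(2) by blast
    ultimately show ?thesis using bounded_subset by blast
  qed
  have w_eq: "w = (\<lambda>x. (c * \<phi> x) *\<^sub>R g i x)" by (simp add: w_def v_def fun_eq_iff)
  have c\<phi>: "continuous_on UNIV (\<lambda>x. c * \<phi> x)" by (intro continuous_intros test_function_continuous[OF \<phi>])
  interpret s: steering_field \<Omega> m g i "\<lambda>x. c * \<phi> x"
  proof
    show "bounded (range (\<lambda>x. c * \<phi> x))" by (rule bdd[OF c\<phi>]) (simp add: K(3))
    show "bounded (range (\<lambda>x. (c * \<phi> x) *\<^sub>R g i x))"
      using bdd[OF w.cont] w.outside unfolding w_eq by blast
    show "c * \<phi> x = 0" if "x \<notin> \<Omega>" for x
    proof -
      have "x \<notin> K" using that K(2) by blast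
      then show ?thesis using K(3) by simp
    qed
    show "norm ((c * \<phi> x) *\<^sub>R g i x - (c * \<phi> y) *\<^sub>R g i y) \<le> 1 / 2 * norm (x - y)" for x y
      using lip[of x y] unfolding w_eq .
  qed (use i c\<phi> in auto)
  have "U \<subseteq> \<Omega>" using interior_subset unfolding U_def regularly_reaching_def by blast
  then have "bounded U" using \<Omega>(2) bounded_subset by blast
  then have "(\<integral>x. indicator U x * (\<Sum>j\<in>UNIV. partial j w x $ j) \<partial>lborel) = 0"
  proof (rule w.integral_divergence_over_invariant_set[rotated])
    show "open U" by (simp add: U_def)
    show "\<gamma> 0 \<in> U \<longleftrightarrow> \<gamma> t \<in> U" if "integral_curve w \<gamma>" "t \<in> {0..1}" for \<gamma> t
      using s.interior_regularly_reaching_invariant[OF \<Omega>(1), of \<gamma> t B] that unfolding U_def w_eq by blast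
  qed
  moreover have "indicator U x * (\<Sum>j\<in>UNIV. partial j w x $ j) = (- c) * (indicator U x * X_adj (g i) \<phi> x)" for x
    by (simp add: v(3) partial_w sum_distrib_left[symmetric])
  ultimately show ?thesis using c(1) by simp
qed

section \<open>The indicator function of the reaching set\<close>

lemma has_weak_X_unique_0:
  assumes "open \<Omega>" "bounded \<Omega>"
    and 0: "has_weak_X \<Omega> g f (\<lambda>x. 0)" and w: "has_weak_X \<Omega> g f w"
  shows "AE x in lebesgue_on \<Omega>. w x = 0"
proof (rule AE_eq_0_if_test_integrals_0[OF \<open>open \<Omega>\<close>])
  have "finite_measure (lebesgue_on \<Omega>)"
    using assms(1,2) by (intro finite_measure_lebesgue_on lmeasurable_open)
  then show "integrable (lebesgue_on \<Omega>) w"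
  proof (rule finite_measure.square_integrable_imp_integrable)
    show "w \<in> borel_measurable (lebesgue_on \<Omega>)" "integrable (lebesgue_on \<Omega>) (\<lambda>x. (w x)\<^sup>2)"
      using w unfolding has_weak_X_def L2_fun_def by simp_all
  qed
  show "(\<integral>x. w x * \<phi> x \<partial>lebesgue_on \<Omega>) = 0" if "\<phi> \<in> test_functions \<Omega>" for \<phi>
  proof -
    have "(\<integral>x. w x * \<phi> x \<partial>lebesgue_on \<Omega>) = (\<integral>x. f x * X_adj g \<phi> x \<partial>lebesgue_on \<Omega>)"
      using w that unfolding has_weak_X_def by blast
    moreover have "(\<integral>x. 0 * \<phi> x \<partial>lebesgue_on \<Omega>) = (\<integral>x. f x * X_adj g \<phi> x \<partial>lebesgue_on \<Omega>)"
      using 0 that unfolding has_weak_X_def by blast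
    ultimately show ?thesis by simp
  qed
qed

text \<open>
  The form involves an arbitrary representative of the weak derivative, which vanishes
  almost everywhere.
\<close>

lemma sigma_form_eq_0:
  assumes "open \<Omega>" "bounded \<Omega>" and 0: "\<And>i. i < m \<Longrightarrow> has_weak_X \<Omega> (g i) f (\<lambda>x. 0)"
  shows "sigma_form \<Omega> m g u f = 0"
  unfolding sigma_form_def
proof (rule sum.neutral, rule ballI)
  fix i assume "i \<in> {..<m}"
  then have i: "has_weak_X \<Omega> (g i) f (\<lambda>x. 0)" using 0 by simp
  have "has_weak_X \<Omega> (g i) f (weak_X \<Omega> (g i) f)"
    unfolding weak_X_def by (rule someI[of "has_weak_X \<Omega> (g i) f", OF i])
  from has_weak_X_unique_0[OF assms(1,2) i this]
  have "AE x in lebesgue_on \<Omega>. weak_X \<Omega> (g i) f x = 0" .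
  then show "(\<integral>x. weak_X \<Omega> (g i) u x * weak_X \<Omega> (g i) f x \<partial>lebesgue_on \<Omega>) = 0"
    by (intro integral_eq_zero_AE) (rule eventually_mono, assumption, simp)
qed

lemma indicator_L2_fun:
  assumes "finite_measure M" "A \<in> sets M"
  shows "(indicator A :: 'a \<Rightarrow> real) \<in> L2_fun M"
proof -
  interpret finite_measure M by fact
  have "(\<lambda>x. (norm (indicator A x :: real))\<^sup>2) = indicator A" by (auto simp: indicator_def)
  then show ?thesis using assms(2) by (simp add: L2_fun_def less_top[symmetric])
qed

theorem theorem1p3:
  fixes \<Omega> :: "(real^'d) set" and m :: nat and g :: "nat \<Rightarrow> real^'d \<Rightarrow> real^'d"
    and R :: real and y :: "real^'d"
  assumes "\<Omega> \<noteq> {}" and "bounded \<Omega>" and "open \<Omega>"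
    and "m \<le> CARD('d)"
    and "\<And>i. i < m \<Longrightarrow> C_k_closure 2 (g i) \<Omega>"
    and "sub_laplacian_invertible \<Omega> m g"
    and "R > 0" and "y \<in> \<Omega>"
  shows "\<Omega> - Reach_inv \<Omega> m g (ball y R) \<in> null_sets lebesgue"
proof -
  define A where "A = regularly_reaching \<Omega> m g (ball y R)"
  define U where "U = interior A"
  have A_sub: "A \<subseteq> Reach_inv \<Omega> m g (ball y R)"
  proof
    fix x assume "x \<in> A"
    then obtain \<gamma> where \<gamma>: "x \<in> \<Omega>" "regular_trajectory \<Omega> m g \<gamma>" "\<gamma> 0 = x" "\<gamma> 1 \<in> ball y R"
      unfolding A_def regularly_reaching_def by blast
    have "continuous_on \<Omega> (g i)" if "i < m" for i
      using assms(5)[OF that] by (simp add: numeral_2_eq_2 extends_continuously_imp_continuous_on)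
    from regular_trajectory_imp_trajectory[OF \<gamma>(2) this]
    show "x \<in> Reach_inv \<Omega> m g (ball y R)"
      unfolding Reach_inv_def using \<gamma> by blast
  qed
  have U: "open U" "U \<subseteq> A" "U \<subseteq> \<Omega>"
    using interior_subset[of A] by (auto simp: U_def A_def regularly_reaching_def)
  have "\<Omega> \<inter> ball y R \<subseteq> A"
  proof
    fix x assume "x \<in> \<Omega> \<inter> ball y R"
    then show "x \<in> A"
      unfolding A_def regularly_reaching_def using regular_trajectory_const[of x \<Omega> m g]
      by (intro CollectI conjI exI[of _ "\<lambda>t. x"]) auto
  qed
  then have "\<Omega> \<inter> ball y R \<subseteq> U"
    unfolding U_def using \<open>open \<Omega>\<close> by (intro interior_maximal) auto
  then have "y \<in> U" using \<open>y \<in> \<Omega>\<close> \<open>R > 0\<close> by auto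
  have lm: "\<Omega> \<in> lmeasurable" "U \<in> lmeasurable"
    using U \<open>bounded \<Omega>\<close> \<open>open \<Omega>\<close> bounded_subset[OF \<open>bounded \<Omega>\<close> U(3)] by (simp_all add: lmeasurable_open)
  have fin: "finite_measure (lebesgue_on \<Omega>)" using lm(1) by (rule finite_measure_lebesgue_on)
  interpret finite_measure "lebesgue_on \<Omega>" by (rule fin)
  have US: "U \<in> sets (lebesgue_on \<Omega>)"
    using U lm by (simp add: sets_restrict_space_iff fmeasurableD)
  have L2U: "(indicator U :: real^'d \<Rightarrow> real) \<in> L2_fun (lebesgue_on \<Omega>)" by (rule indicator_L2_fun[OF fin US])
  have weak: "has_weak_X \<Omega> (g i) (indicator U) (\<lambda>x. 0)" if i: "i < m" for i
    unfolding has_weak_X_def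
  proof (intro conjI ballI L2U)
    show "(\<lambda>x. 0) \<in> L2_fun (lebesgue_on \<Omega>)" by (simp add: L2_fun_def)
    fix \<phi> assume \<phi>: "\<phi> \<in> test_functions \<Omega>"
    have "X_adj (g i) \<phi> = (\<lambda>x. - (\<Sum>j\<in>UNIV. partial j (\<lambda>x. \<phi> x *\<^sub>R g i x) x $ j))"
      by (rule ext) (rule test_function_times_field(3)[OF \<open>open \<Omega>\<close> assms(5)[OF i] \<phi>])
    then have "continuous_on UNIV (X_adj (g i) \<phi>)"
      by (simp add: continuous_intros test_function_times_field(2)[OF \<open>open \<Omega>\<close> assms(5)[OF i] \<phi>])
    then have [measurable]: "X_adj (g i) \<phi> \<in> borel_measurable borel" by (rule borel_measurable_continuous_onI)
    have [measurable]: "U \<in> sets borel" using U by simp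
    have "(\<integral>x. indicator U x * X_adj (g i) \<phi> x \<partial>lebesgue_on \<Omega>)
        = (\<integral>x. indicator \<Omega> x *\<^sub>R (indicator U x * X_adj (g i) \<phi> x) \<partial>lebesgue)"
      using lm by (intro integral_restrict_space) (auto simp: fmeasurableD)
    also have "\<dots> = (\<integral>x. indicator U x * X_adj (g i) \<phi> x \<partial>lebesgue)"
      using U(3) by (intro Bochner_Integration.integral_cong) (auto simp: indicator_def)
    also have "\<dots> = (\<integral>x. indicator U x * X_adj (g i) \<phi> x \<partial>lborel)"
      by (rule integral_completion) measurable
    also have "\<dots> = 0"
      unfolding U_def A_def
      by (rule integral_X_adj_over_reaching_set[where g = g and i = i, OF \<open>open \<Omega>\<close> \<open>bounded \<Omega>\<close> i assms(5)[OF i] \<phi>])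
    finally show "(\<integral>x. 0 * \<phi> x \<partial>lebesgue_on \<Omega>) = (\<integral>x. indicator U x * X_adj (g i) \<phi> x \<partial>lebesgue_on \<Omega>)"
      by simp
  qed
  then have WH1: "indicator U \<in> WH1 \<Omega> m g"
    unfolding WH1_def by (intro CollectI conjI L2U allI impI exI)
  have int_U: "(\<integral>x. indicator U x \<partial>lebesgue_on \<Omega>) = measure lebesgue U"
    using U(3) lm US by (simp add: measure_restrict_space fmeasurableD Int_absorb2)
  have int_1: "(\<integral>x. 1 \<partial>lebesgue_on \<Omega>) = measure lebesgue \<Omega>"
    using lm by (simp add: measure_restrict_space fmeasurableD)
  have nonneg: "measure lebesgue U > 0"
    using open_not_negligible[OF U(1)] \<open>y \<in> U\<close> negligible_iff_measure0[OF lm(2)] zero_less_measure_iff by blast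
  have "measure lebesgue U \<le> measure lebesgue \<Omega>"
    using U(3) lm by (intro measure_mono_fmeasurable) (auto simp: fmeasurableD)
  then have pos\<Omega>: "measure lebesgue \<Omega> > 0" using nonneg by linarith
  \<comment> \<open>The projection of the indicator of \<open>U\<close> to $L^2_\perp(\Omega)$.\<close>
  define c where "c = measure lebesgue U / measure lebesgue \<Omega>"
  define h where "h x = indicator U x - c" for x
  have ind_int: "integrable (lebesgue_on \<Omega>) (indicator U :: _ \<Rightarrow> real)"
    using US by (intro integrable_real_indicator) (auto simp: less_top[symmetric])
  have h: "h \<in> L2_perp \<Omega>"
  proof -
    have "(\<lambda>x. (norm (h x))\<^sup>2) = (\<lambda>x. (1 - 2 * c) * indicator U x + c\<^sup>2)"
      by (auto simp: h_def fun_eq_iff power2_eq_square algebra_simps split: split_indicator)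
    then have "integrable (lebesgue_on \<Omega>) (\<lambda>x. (norm (h x))\<^sup>2)" using ind_int by simp
    moreover have "h \<in> borel_measurable (lebesgue_on \<Omega>)"
      unfolding h_def[abs_def] using US by measurable
    moreover have "(\<integral>x. h x \<partial>lebesgue_on \<Omega>) = 0"
      using ind_int int_U int_1 pos\<Omega> by (simp add: h_def c_def)
    ultimately show ?thesis by (simp add: L2_perp_def L2_fun_def)
  qed
  obtain T where T: "T h \<in> sub_laplacian_dom \<Omega> m g" "AE x in lebesgue_on \<Omega>. sub_laplacian \<Omega> m g (T h) x = h x"
    using assms(6) h unfolding sub_laplacian_invertible_def by blast
  define f where "f = (SOME f. sigma_represents \<Omega> m g (T h) f)"
  have f: "sigma_represents \<Omega> m g (T h) f"
    using T(1) someI[of "sigma_represents \<Omega> m g (T h)"] unfolding sub_laplacian_dom_def f_def by blast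
  then have "sigma_form \<Omega> m g (T h) (indicator U) = (\<integral>x. f x * indicator U x \<partial>lebesgue_on \<Omega>)"
    using WH1 unfolding sigma_represents_def L2_inner_def by blast
  then have "0 = (\<integral>x. f x * indicator U x \<partial>lebesgue_on \<Omega>)"
    using sigma_form_eq_0[OF \<open>open \<Omega>\<close> \<open>bounded \<Omega>\<close> weak, where u = "T h"] by simp
  also have "\<dots> = (\<integral>x. - h x * indicator U x \<partial>lebesgue_on \<Omega>)"
  proof (rule integral_cong_AE)
    show "AE x in lebesgue_on \<Omega>. f x * indicator U x = - h x * indicator U x"
      using T(2)
    proof eventually_elim
      case (elim x)
      then have "h x = - f x" by (simp add: sub_laplacian_def f_def)
      then show ?case by simp
    qed
    show "(\<lambda>x. f x * indicator U x) \<in> borel_measurable (lebesgue_on \<Omega>)"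
      using f US unfolding sigma_represents_def L2_fun_def by auto
    show "(\<lambda>x. - h x * indicator U x) \<in> borel_measurable (lebesgue_on \<Omega>)"
      unfolding h_def[abs_def] using US by measurable
  qed
  also have "\<dots> = (\<integral>x. (c - 1) * indicator U x \<partial>lebesgue_on \<Omega>)"
    by (intro Bochner_Integration.integral_cong) (auto simp: h_def indicator_def)
  also have "\<dots> = (c - 1) * measure lebesgue U" using int_U by simp
  finally have "c = 1" using nonneg by simp
  then have "measure lebesgue U = measure lebesgue \<Omega>" using pos\<Omega> by (simp add: c_def)
  then have "measure lebesgue (\<Omega> - U) = 0"
    using U(3) lm measurable_measure_Diff[of \<Omega> lebesgue U] by (simp add: fmeasurableD)
  then have "negligible (\<Omega> - U)" using lm by (simp add: negligible_iff_measure0 fmeasurable_Diff fmeasurableD)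
  then have "negligible (\<Omega> - Reach_inv \<Omega> m g (ball y R))"
    by (rule negligible_subset) (use U(2) A_sub in blast)
  then show ?thesis by (simp add: negligible_iff_null_sets)
qed

end
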